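(* Let $\alpha\in\mathbb R$. There is an infinite sequence of real numbers $\lambda$ for which Mathieu's equation $y''+(\lambda+\alpha\cos2x)y=0$ has a non-trivial real $2\pi$-periodic solution. Let $A$ be such a non-trivial real $2\pi$-periodic solution (for one such $\lambda$), and let $$W(x,y)=\frac{A(x)A'(y)-A'(x)A(y)}{\sin(x-y)},$$ which extends to a continuously differentiable function on $\mathbb R^2$, $2\pi$-periodic in each variable. Then: (i) $W$ defines a self-adjoint Hilbert–Schmidt integral operator on $L^2[0,2\pi]$; (ii) if $\nu\neq0$ is a simple eigenvalue of this operator, then any corresponding eigenfunction $f$ (extended $2\pi$-periodically) is twice continuously differentiable and is a $2\pi$-periodic solution of $f''+(\mu+\alpha\cos2x)f=0$ for some constant $\mu$. *)

theory Defs
  imports "HOL-Analysis.Analysis"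
begin

definition mathieu_sol :: "real \<Rightarrow> real \<Rightarrow> (real \<Rightarrow> real) \<Rightarrow> bool" where
  "mathieu_sol alpha lam y \<longleftrightarrow>
     (\<exists>y'. \<forall>x. (y has_real_derivative y' x) (at x) \<and>
               (y' has_real_derivative (- (lam + alpha * cos (2 * x)) * y x)) (at x))"

definition periodic2pi :: "(real \<Rightarrow> real) \<Rightarrow> bool" where
  "periodic2pi y \<longleftrightarrow> (\<forall>x. y (x + 2 * pi) = y x)"

definition mathieu_periodic_sol :: "real \<Rightarrow> real \<Rightarrow> (real \<Rightarrow> real) \<Rightarrow> bool" where
  "mathieu_periodic_sol alpha lam y \<longleftrightarrow>
     mathieu_sol alpha lam y \<and> periodic2pi y \<and> (\<exists>x. y x \<noteq> 0)"

definition C2_fun :: "(real \<Rightarrow> real) \<Rightarrow> bool" where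
  "C2_fun g \<longleftrightarrow> (\<exists>g' g''. (\<forall>x. (g has_real_derivative g' x) (at x) \<and>
                                 (g' has_real_derivative g'' x) (at x)) \<and>
                           continuous_on UNIV g'')"

definition C1_fun2 :: "(real \<Rightarrow> real \<Rightarrow> real) \<Rightarrow> bool" where
  "C1_fun2 W \<longleftrightarrow> (\<exists>W' :: real \<times> real \<Rightarrow> ((real \<times> real) \<Rightarrow>\<^sub>L real).
       (\<forall>z. ((\<lambda>p. W (fst p) (snd p)) has_derivative blinfun_apply (W' z)) (at z)) \<and>
       continuous_on UNIV W')"

definition L2 :: "(real \<Rightarrow> real) \<Rightarrow> bool" where
  "L2 f \<longleftrightarrow> set_borel_measurable lebesgue {0..2*pi} f \<and>
            set_integrable lebesgue {0..2*pi} (\<lambda>x. (f x)\<^sup>2)"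

definition int_op :: "(real \<Rightarrow> real \<Rightarrow> real) \<Rightarrow> (real \<Rightarrow> real) \<Rightarrow> real \<Rightarrow> real" where
  "int_op W f x = set_lebesgue_integral lebesgue {0..2*pi} (\<lambda>y. W x y * f y)"

definition hilbert_schmidt_kernel :: "(real \<Rightarrow> real \<Rightarrow> real) \<Rightarrow> bool" where
  "hilbert_schmidt_kernel W \<longleftrightarrow>
     set_borel_measurable (lebesgue \<Otimes>\<^sub>M lebesgue) ({0..2*pi} \<times> {0..2*pi}) (\<lambda>(x,y). W x y) \<and>
     set_integrable (lebesgue \<Otimes>\<^sub>M lebesgue) ({0..2*pi} \<times> {0..2*pi}) (\<lambda>(x,y). (W x y)\<^sup>2)"

definition self_adjoint_kernel :: "(real \<Rightarrow> real \<Rightarrow> real) \<Rightarrow> bool" where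
  "self_adjoint_kernel W \<longleftrightarrow>
     (\<forall>f g. L2 f \<and> L2 g \<longrightarrow>
        set_lebesgue_integral lebesgue {0..2*pi} (\<lambda>x. int_op W f x * g x) =
        set_lebesgue_integral lebesgue {0..2*pi} (\<lambda>x. f x * int_op W g x))"

definition eigenfun :: "(real \<Rightarrow> real \<Rightarrow> real) \<Rightarrow> real \<Rightarrow> (real \<Rightarrow> real) \<Rightarrow> bool" where
  "eigenfun W nu f \<longleftrightarrow> L2 f \<and>
     \<not> (AE x in lebesgue. x \<in> {0..2*pi} \<longrightarrow> f x = 0) \<and>
     (AE x in lebesgue. x \<in> {0..2*pi} \<longrightarrow> int_op W f x = nu * f x)"

definition simple_eigenvalue :: "(real \<Rightarrow> real \<Rightarrow> real) \<Rightarrow> real \<Rightarrow> bool" where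
  "simple_eigenvalue W nu \<longleftrightarrow> (\<exists>f. eigenfun W nu f) \<and>
     (\<forall>f g. eigenfun W nu f \<and> eigenfun W nu g \<longrightarrow>
        (\<exists>c. AE x in lebesgue. x \<in> {0..2*pi} \<longrightarrow> g x = c * f x))"

end

theory Submission
  imports Defs
begin

text \<open>
  Existence of periodic solutions: for \<open>\<lambda> = k\<^sup>2\<close> the solution with \<open>y 0 = 0\<close>, \<open>y' 0 = 1\<close> is odd, is
  \<open>2\<pi>\<close>-periodic as soon as \<open>y \<pi> = 0\<close>, and satisfies \<open>k y(\<pi>) = sin (k \<pi>) + O(1 / k)\<close>; the intermediate
  value theorem in \<open>k\<close> between consecutive half-integers yields arbitrarily large \<open>\<lambda>\<close>.

  Eigenfunctions: a periodic solution is \<open>\<pi>\<close>-periodic or \<open>\<pi>\<close>-antiperiodic, which removes the singularities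
  of \<open>W\<close>, and \<open>W\<^sub>x + W\<^sub>y = - 2 \<alpha> sin (x + y) A(x) A(y)\<close>. Applying this identity twice together with
  integration by parts shows, using only that \<open>W\<close> is \<open>C\<^sup>1\<close>, that the integral operator commutes with
  \<open>L = d\<^sup>2/dx\<^sup>2 + \<alpha> cos 2x\<close>. Hence \<open>L\<close> maps a one-dimensional eigenspace into itself.
\<close>

section \<open>Uniqueness and Floquet multipliers\<close>

text \<open>The commutation is the weak form of a formal identity. Applying
  \<open>d/dx - d/dy\<close> to the formula for \<open>W_x + W_y\<close> gives
  \<open>W_xx - W_yy = 2 alpha sin(x + y) (A(x) A'(y) - A'(x) A(y))\<close>. The bracket is
  \<open>sin(x - y) W\<close>, and \<open>2 sin(x + y) sin(x - y) = cos 2y - cos 2x\<close>, so the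
  Mathieu operators in x and in y act alike on \<open>W\<close>. This is what the sine in the
  denominator is for: \<open>d/dx + d/dy\<close> annihilates functions of \<open>x - y\<close>, and
  the product of the two sines reproduces the potential. Second derivatives of \<open>W\<close> are
  not at hand, so every new derivative of an eigenfunction requires moving the previous one off the
  kernel by parts. For existence, periodicity is in general a two-dimensional condition on initial
  data. For the odd solution it reduces to one scalar equation at \<open>pi\<close>, which the
  intermediate value theorem can solve.\<close>

lemma hill_unique:
  fixes q y y' :: "real \<Rightarrow> real"
  assumes y: "\<And>x. (y has_real_derivative y' x) (at x)"
    and y': "\<And>x. (y' has_real_derivative - q x * y x) (at x)"
    and q: "\<And>x. \<bar>q x\<bar> \<le> M"
    and zero: "y a = 0" "y' a = 0"
  shows "y x = 0"
proof -
  \<comment> \<open>Energy argument: \<open>|E'| \<le> (1 + M) E\<close>, so \<open>E\<close> times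
    a decaying exponential is nonincreasing to the right of \<open>a\<close>, and \<open>E\<close>
    times a growing one is nondecreasing to the left; \<open>E a = 0\<close> then forces
    \<open>E = 0\<close>.\<close>
  define E where "E = (\<lambda>x. (y x)\<^sup>2 + (y' x)\<^sup>2)"
  define E' where "E' = (\<lambda>x. (1 - q x) * (2 * (y x * y' x)))"
  have E: "(E has_real_derivative E' x) (at x)" for x
    unfolding E_def E'_def
    by (rule derivative_eq_intros y y' refl)+ (simp add: algebra_simps)
  have bound: "\<bar>E' x\<bar> \<le> (1 + M) * E x" for x
  proof -
    have "2 * \<bar>y x * y' x\<bar> \<le> E x"
      using sum_squares_bound[of "\<bar>y x\<bar>" "\<bar>y' x\<bar>"] by (simp add: E_def abs_mult)
    moreover have "\<bar>1 - q x\<bar> \<le> 1 + M" using q[of x] by linarith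
    ultimately have "\<bar>1 - q x\<bar> * (2 * \<bar>y x * y' x\<bar>) \<le> (1 + M) * E x"
      by (intro mult_mono) auto
    moreover have "\<bar>E' x\<bar> = \<bar>1 - q x\<bar> * (2 * \<bar>y x * y' x\<bar>)"
      unfolding E'_def by (simp only: abs_mult abs_numeral)
    ultimately show ?thesis by simp
  qed
  have "E x \<le> 0"
  proof (cases "x \<ge> a")
    case True
    have "E x * exp (- (1 + M) * x) \<le> E a * exp (- (1 + M) * a)"
    proof (rule DERIV_nonpos_imp_nonincreasing[OF True])
      fix t
      have "((\<lambda>x. E x * exp (- (1 + M) * x)) has_real_derivative
             (E' t - (1 + M) * E t) * exp (- (1 + M) * t)) (at t)"
        by (rule derivative_eq_intros E refl)+ (simp add: algebra_simps)
      moreover have "(E' t - (1 + M) * E t) * exp (- (1 + M) * t) \<le> 0"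
        using bound[of t] by (intro mult_nonpos_nonneg) auto
      ultimately show "\<exists>d. ((\<lambda>x. E x * exp (- (1 + M) * x)) has_real_derivative d) (at t) \<and> d \<le> 0"
        by blast
    qed
    then show ?thesis using zero by (simp add: E_def mult_le_0_iff)
  next
    case False
    then have "x \<le> a" by simp
    have "E x * exp ((1 + M) * x) \<le> E a * exp ((1 + M) * a)"
    proof (rule DERIV_nonneg_imp_nondecreasing[OF \<open>x \<le> a\<close>])
      fix t
      have "((\<lambda>x. E x * exp ((1 + M) * x)) has_real_derivative
             (E' t + (1 + M) * E t) * exp ((1 + M) * t)) (at t)"
        by (rule derivative_eq_intros E refl)+ (simp add: algebra_simps)
      moreover have "(E' t + (1 + M) * E t) * exp ((1 + M) * t) \<ge> 0"
        using bound[of t] by (intro mult_nonneg_nonneg) auto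
      ultimately show "\<exists>d. ((\<lambda>x. E x * exp ((1 + M) * x)) has_real_derivative d) (at t) \<and> d \<ge> 0"
        by blast
    qed
    then show ?thesis using zero by (simp add: E_def mult_le_0_iff)
  qed
  then show ?thesis by (simp add: E_def sum_power2_le_zero_iff)
qed

text \<open>\<open>mathieu_sol\<close> hides the derivative under an existential. As a parameter it
  can be named in initial data, in Wronskians and for shifted, reflected or combined
  solutions.\<close>

definition mathieu_pair :: "real \<Rightarrow> real \<Rightarrow> (real \<Rightarrow> real) \<Rightarrow> (real \<Rightarrow> real) \<Rightarrow> bool" where
  "mathieu_pair alpha lam y y' \<longleftrightarrow>
     (\<forall>x. (y has_real_derivative y' x) (at x) \<and>
          (y' has_real_derivative - (lam + alpha * cos (2 * x)) * y x) (at x))"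

lemma mathieu_pair_unique:
  assumes "mathieu_pair alpha lam y y'" "y a = 0" "y' a = 0"
  shows "y x = 0"
proof (rule hill_unique[where q = "\<lambda>x. lam + alpha * cos (2 * x)" and M = "\<bar>lam\<bar> + \<bar>alpha\<bar>"
      and y = y and y' = y' and a = a])
  show "\<bar>lam + alpha * cos (2 * x)\<bar> \<le> \<bar>lam\<bar> + \<bar>alpha\<bar>" for x
    using mult_left_le[of "\<bar>cos (2 * x)\<bar>" "\<bar>alpha\<bar>"]
      abs_triangle_ineq[of lam "alpha * cos (2 * x)"] by (simp add: abs_mult)
qed (use assms in \<open>auto simp: mathieu_pair_def\<close>)

lemma mathieu_pair_combine:
  assumes "mathieu_pair alpha lam u u'" "mathieu_pair alpha lam v v'"
  shows "mathieu_pair alpha lam (\<lambda>x. a * u x + b * v x) (\<lambda>x. a * u' x + b * v' x)"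
  unfolding mathieu_pair_def
proof (intro allI conjI)
  fix x
  note D = assms[unfolded mathieu_pair_def, rule_format, of x]
  show "((\<lambda>x. a * u x + b * v x) has_real_derivative a * u' x + b * v' x) (at x)"
    by (rule derivative_eq_intros D[THEN conjunct1] refl)+ simp
  show "((\<lambda>x. a * u' x + b * v' x) has_real_derivative
      - (lam + alpha * cos (2 * x)) * (a * u x + b * v x)) (at x)"
    by (rule derivative_eq_intros D[THEN conjunct2] refl)+ (simp add: algebra_simps)
qed

lemma mathieu_pair_unique2:
  assumes "mathieu_pair alpha lam u u'" "mathieu_pair alpha lam v v'" "u a = v a" "u' a = v' a"
  shows "u x = v x"
  using mathieu_pair_unique[OF mathieu_pair_combine[OF assms(1,2), of 1 "-1"], of a x] assms(3,4)
  by simp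

lemma mathieu_pair_shift_pi:
  assumes "mathieu_pair alpha lam u u'"
  shows "mathieu_pair alpha lam (\<lambda>x. u (x + pi)) (\<lambda>x. u' (x + pi))"
  unfolding mathieu_pair_def
proof (intro allI conjI)
  fix x
  note D = assms[unfolded mathieu_pair_def, rule_format, of "x + pi"]
  show "((\<lambda>x. u (x + pi)) has_real_derivative u' (x + pi)) (at x)"
    using D[THEN conjunct1] by (simp add: DERIV_shift)
  have "cos (2 * (x + pi)) = cos (2 * x)" by (simp add: distrib_left)
  then show "((\<lambda>x. u' (x + pi)) has_real_derivative - (lam + alpha * cos (2 * x)) * u (x + pi)) (at x)"
    using D[THEN conjunct2] by (simp add: DERIV_shift)
qed

text \<open>With the outer sign, reflection keeps the derivative at 0 and negates the value, so a
  solution vanishing at 0 shares its initial data with its reflection.\<close>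

lemma mathieu_pair_reflect:
  assumes "mathieu_pair alpha lam u u'"
  shows "mathieu_pair alpha lam (\<lambda>x. - u (- x)) (\<lambda>x. u' (- x))"
  unfolding mathieu_pair_def
proof (intro allI conjI)
  fix x
  note D = assms[unfolded mathieu_pair_def, rule_format, of "- x"]
  show "((\<lambda>x. - u (- x)) has_real_derivative u' (- x)) (at x)"
    using DERIV_minus[OF D[THEN conjunct1, unfolded DERIV_mirror]] by simp
  show "((\<lambda>x. u' (- x)) has_real_derivative - (lam + alpha * cos (2 * x)) * - u (- x)) (at x)"
    using D[THEN conjunct2, unfolded DERIV_mirror] by simp
qed

lemma wronskian_const:
  assumes "mathieu_pair alpha lam u u'" "mathieu_pair alpha lam v v'"
  shows "u x * v' x - u' x * v x = u y * v' y - u' y * v y"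
proof (rule DERIV_isconst_all[where f = "\<lambda>x. u x * v' x - u' x * v x"])
  show "\<forall>x. DERIV (\<lambda>x. u x * v' x - u' x * v x) x :> 0"
  proof
    fix x
    note D = assms[unfolded mathieu_pair_def, rule_format, of x]
    show "DERIV (\<lambda>x. u x * v' x - u' x * v x) x :> 0"
      by (rule derivative_eq_intros D[THEN conjunct1] D[THEN conjunct2] refl)+ (simp add: algebra_simps)
  qed
qed

text \<open>The Floquet multipliers have product 1, so 1 and -1 are not both multipliers.\<close>

lemma periodic_imp_semiperiodic:
  assumes A: "mathieu_pair alpha lam A A'" and per: "\<And>x. A (x + 2 * pi) = A x"
  obtains s where "s = 1 \<or> s = -1" "\<And>x. A (x + pi) = s * A x" "\<And>x. A' (x + pi) = s * A' x"
proof -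
  note S = mathieu_pair_shift_pi[OF A]
  \<comment> \<open>Twice the components of \<open>A\<close> in the eigenspaces of the shift by
    \<open>pi\<close> for 1 and -1. The explicit factors match
    \<open>mathieu_pair_combine\<close>.\<close>
  define P P' M M' where PM: "P = (\<lambda>x. 1 * A x + 1 * A (x + pi))" "P' = (\<lambda>x. 1 * A' x + 1 * A' (x + pi))"
    "M = (\<lambda>x. 1 * A x + (-1) * A (x + pi))" "M' = (\<lambda>x. 1 * A' x + (-1) * A' (x + pi))"
  have P: "mathieu_pair alpha lam P P'" and M: "mathieu_pair alpha lam M M'"
    unfolding PM using mathieu_pair_combine[OF A S] by blast+
  have DA: "deriv A x = A' x" for x
    using A by (auto simp: mathieu_pair_def intro: DERIV_imp_deriv)
  have per': "A' (x + 2 * pi) = A' x" for x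
  proof -
    have "((\<lambda>x. A (x + 2 * pi)) has_real_derivative A' (x + 2 * pi)) (at x)"
      using A by (intro DERIV_shift[THEN iffD1]) (simp add: mathieu_pair_def)
    moreover have "(\<lambda>x. A (x + 2 * pi)) = A" using per by auto
    ultimately show ?thesis using DA DERIV_imp_deriv by metis
  qed
  have pp: "x + pi + pi = x + 2 * pi" for x by simp
  have sh: "P (x + pi) = P x" "P' (x + pi) = P' x" "M (x + pi) = - M x" "M' (x + pi) = - M' x" for x
    unfolding PM pp using per per' by auto
  \<comment> \<open>The shift by \<open>pi\<close> fixes \<open>P\<close> and negates
    \<open>M\<close>, so it negates their Wronskian, which is constant.\<close>
  have w0: "P 0 * M' 0 - P' 0 * M 0 = 0"
    using wronskian_const[OF P M, of "0 + pi" 0] unfolding sh by linarith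
  have "(\<forall>x. P x = 0) \<or> (\<forall>x. M x = 0)"
  proof (cases "P 0 = 0 \<and> P' 0 = 0")
    case True
    then show ?thesis using mathieu_pair_unique[OF P] by blast
  next
    case False
    obtain c where c: "M 0 = c * P 0" "M' 0 = c * P' 0"
    proof (cases "P 0 = 0")
      case True
      then have "M 0 = M' 0 / P' 0 * P 0" "M' 0 = M' 0 / P' 0 * P' 0" using False w0 by auto
      then show ?thesis by (rule that)
    next
      case False
      have "M 0 * P' 0 = M' 0 * P 0" using w0 by (simp add: mult.commute)
      then have "M 0 = M 0 / P 0 * P 0" "M' 0 = M 0 / P 0 * P' 0" using False by auto
      then show ?thesis by (rule that)
    qed
    have "M x = c * P x" for x
      using mathieu_pair_unique2[OF M mathieu_pair_combine[OF P P, of c 0], of 0 x] c by simp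
    \<comment> \<open>A multiple of \<open>P\<close>, \<open>M\<close> is both
      \<open>pi\<close>-periodic and \<open>pi\<close>-antiperiodic.\<close>
    then have "M x = 0" for x using sh(1)[of x] sh(3)[of x] by simp
    then show ?thesis by blast
  qed
  then have "\<exists>s. (s = 1 \<or> s = -1) \<and> (\<forall>x. A (x + pi) = s * A x)"
  proof
    assume *: "\<forall>x. P x = 0"
    have "A (x + pi) = (-1) * A x" for x using *[rule_format, of x] by (simp add: PM)
    then show ?thesis by blast
  next
    assume *: "\<forall>x. M x = 0"
    have "A (x + pi) = 1 * A x" for x using *[rule_format, of x] by (simp add: PM)
    then show ?thesis by blast
  qed
  then obtain s where s: "s = 1 \<or> s = -1" "\<And>x. A (x + pi) = s * A x" by blast
  have "A' (x + pi) = s * A' x" for x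
  proof -
    have "(\<lambda>x. A (x + pi)) = (\<lambda>x. s * A x)" using s by auto
    moreover have "((\<lambda>x. A (x + pi)) has_real_derivative A' (x + pi)) (at x)"
      using S by (simp add: mathieu_pair_def)
    moreover have "((\<lambda>x. s * A x) has_real_derivative s * A' x) (at x)"
      using A by (auto simp: mathieu_pair_def intro!: DERIV_cmult)
    ultimately show ?thesis using DERIV_unique by metis
  qed
  then show ?thesis using s that by blast
qed

section \<open>The kernel\<close>

text \<open>The mean of \<open>h'\<close> over the segment from \<open>a\<close> to \<open>x\<close>
  is the difference quotient of \<open>h\<close>, extended over \<open>x = a\<close> without a case
  split.\<close>

lemma hadamard_quotient_eq:
  fixes h h' :: "real \<Rightarrow> real"
  assumes h: "\<And>x. (h has_real_derivative h' x) (at x)"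
  shows "(x - a) * integral {0..1} (\<lambda>t. h' (a + t * (x - a))) = h x - h a"
proof -
  have "((\<lambda>t. (x - a) * h' (a + t * (x - a))) has_integral
          (h (a + 1 * (x - a)) - h (a + 0 * (x - a)))) {0..1}"
  proof (rule fundamental_theorem_of_calculus)
    fix t :: real
    have "((\<lambda>t. h (a + t * (x - a))) has_real_derivative h' (a + t * (x - a)) * (x - a)) (at t)"
      by (rule DERIV_chain2[OF h]) (auto intro!: derivative_eq_intros)
    then show "((\<lambda>t. h (a + t * (x - a))) has_vector_derivative (x - a) * h' (a + t * (x - a)))
        (at t within {0..1})"
      by (simp add: has_real_derivative_iff_has_vector_derivative mult.commute
          has_vector_derivative_at_within)
  qed simp
  from integral_unique[OF this] show ?thesis
    by simp
qed

text \<open>Differentiation under the integral costs one derivative: the difference quotient of a C2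
  function is differentiable at \<open>a\<close> too.\<close>

lemma hadamard_quotient_deriv:
  fixes h' h'' :: "real \<Rightarrow> real"
  assumes h': "\<And>x. (h' has_real_derivative h'' x) (at x)"
    and cont: "continuous_on UNIV h''"
  shows "((\<lambda>x. integral {0..1} (\<lambda>t. h' (a + t * (x - a)))) has_real_derivative
          integral {0..1} (\<lambda>t. t * h'' (a + t * (x - a)))) (at x)"
proof -
  have ch': "continuous_on UNIV h'"
    using h' DERIV_isCont continuous_at_imp_continuous_on by blast
  note [continuous_intros] = continuous_on_compose2[OF ch'] continuous_on_compose2[OF cont]
  have "((\<lambda>x. integral (cbox 0 1) (\<lambda>t. h' (a + t * (x - a)))) has_real_derivative
          integral (cbox 0 1) (\<lambda>t. t * h'' (a + t * (x - a)))) (at x within UNIV)"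
  proof (rule leibniz_rule_field_derivative)
    fix x t :: real
    have "((\<lambda>x. h' (a + t * (x - a))) has_real_derivative h'' (a + t * (x - a)) * t) (at x)"
      by (rule DERIV_chain2[OF h']) (auto intro!: derivative_eq_intros)
    then show "((\<lambda>x. h' (a + t * (x - a))) has_real_derivative t * h'' (a + t * (x - a)))
        (at x within UNIV)"
      by (simp add: mult.commute)
    show "(\<lambda>t. h' (a + t * (x - a))) integrable_on cbox 0 1"
      by (intro integrable_continuous continuous_intros) auto
    show "continuous_on (UNIV \<times> cbox 0 1) (\<lambda>(x, t). t * h'' (a + t * (x - a)))"
      unfolding case_prod_beta by (intro continuous_intros) auto
  qed auto
  then show ?thesis by simp
qed

text \<open>The multiplier \<open>s\<close> carries regularity of the kernel from the diagonal to
  the other lines where \<open>sin (x - y)\<close> vanishes.\<close>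

locale semiperiodic_mathieu =
  fixes alpha lam s :: real and A A' :: "real \<Rightarrow> real"
  assumes pair: "mathieu_pair alpha lam A A'"
    and sgn: "s = 1 \<or> s = -1"
    and shift_A: "A (x + pi) = s * A x"
    and shift_A': "A' (x + pi) = s * A' x"
begin

definition A2 :: "real \<Rightarrow> real" where "A2 x = - (lam + alpha * cos (2 * x)) * A x"

text \<open>The third derivative of \<open>A\<close>. It enters because
  \<open>N x y / (x - y)\<close> is C1 in \<open>x\<close> only at the price of two derivatives of
  \<open>N\<close>, which already contains \<open>A'\<close>.\<close>

definition A3 :: "real \<Rightarrow> real" where
  "A3 x = 2 * alpha * sin (2 * x) * A x - (lam + alpha * cos (2 * x)) * A' x"

lemma deriv_A [derivative_intros]: "(A has_real_derivative A' x) (at x)"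
  and deriv_A' [derivative_intros]: "(A' has_real_derivative A2 x) (at x)"
  using pair by (auto simp: mathieu_pair_def A2_def)

lemma deriv_A2: "(A2 has_real_derivative A3 x) (at x)"
  unfolding A2_def A3_def
  by (rule derivative_eq_intros refl)+ (simp add: algebra_simps)

lemma cont_A [continuous_intros]: "continuous_on S f \<Longrightarrow> continuous_on S (\<lambda>x. A (f x))"
  by (rule continuous_on_compose2[of UNIV A]) (auto intro: DERIV_isCont deriv_A continuous_at_imp_continuous_on)

lemma cont_A' [continuous_intros]: "continuous_on S f \<Longrightarrow> continuous_on S (\<lambda>x. A' (f x))"
  by (rule continuous_on_compose2[of UNIV A']) (auto intro: DERIV_isCont deriv_A' continuous_at_imp_continuous_on)

definition N :: "real \<Rightarrow> real \<Rightarrow> real" where "N x y = A x * A' y - A' x * A y"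
definition Nx :: "real \<Rightarrow> real \<Rightarrow> real" where "Nx x y = A' x * A' y - A2 x * A y"
definition Nxx :: "real \<Rightarrow> real \<Rightarrow> real" where "Nxx x y = A2 x * A' y - A3 x * A y"

lemma deriv_N: "((\<lambda>x. N x y) has_real_derivative Nx x y) (at x)"
  and deriv_Nx: "((\<lambda>x. Nx x y) has_real_derivative Nxx x y) (at x)"
  unfolding N_def Nx_def Nxx_def by (auto intro!: derivative_eq_intros deriv_A2)

text \<open>On the zero set of the sine the value is the limit given by l'Hospital's rule.\<close>

definition W :: "real \<Rightarrow> real \<Rightarrow> real" where
  "W x y = (if sin (x - y) = 0 then Nx x y / cos (x - y) else N x y / sin (x - y))"

text \<open>This one function serves both variables: as \<open>W\<close> is symmetric, its partial
  derivative in the second variable at \<open>(x, y)\<close> is \<open>Wx y x\<close>.\<close>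

definition Wx :: "real \<Rightarrow> real \<Rightarrow> real" where "Wx x y = deriv (\<lambda>x. W x y) x"

lemma W_shift_pi: "W (x + pi) y = - s * W x y"
proof -
  have c: "cos (2 * (x + pi)) = cos (2 * x)" by (simp add: distrib_left)
  have "N (x + pi) y = s * N x y" "Nx (x + pi) y = s * Nx x y"
    unfolding N_def Nx_def A2_def shift_A shift_A' c by (simp_all add: algebra_simps)
  moreover have "sin (x + pi - y) = - sin (x - y)" "cos (x + pi - y) = - cos (x - y)"
    using sin_periodic_pi[of "x - y"] cos_periodic_pi[of "x - y"] by (simp_all add: diff_add_eq)
  ultimately show ?thesis
    by (simp add: W_def)
qed

text \<open>The factor, a power of \<open>- s\<close>, depends on \<open>k\<close> alone, so the
  identity can be differentiated in \<open>x\<close>.\<close>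

lemma W_shift_int:
  obtains c where "\<And>x y. W x y = c * W (x - of_int k * pi) y"
proof -
  have n: "W (x + real n * pi) y = (- s) ^ n * W x y" for n x y
  proof (induction n)
    case (Suc n)
    have "x + real (Suc n) * pi = (x + real n * pi) + pi" by (simp add: algebra_simps)
    then show ?case using W_shift_pi[of "x + real n * pi" y] Suc by (simp only: power_Suc mult.assoc)
  qed simp
  show ?thesis
  proof (cases "k \<ge> 0")
    case True
    then have "W x y = (- s) ^ nat k * W (x - of_int k * pi) y" for x y
      using n[of "x - of_int k * pi" "nat k" y] by simp
    then show ?thesis by (rule that)
  next
    case False
    have "(- s) ^ m * (- s) ^ m = 1" for m
      using sgn by (auto simp: power_mult_distrib[symmetric])
    then have "W x y = (- s) ^ nat (- k) * W (x - of_int k * pi) y" for x y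
      using n[of x "nat (- k)" y] False by (simp add: mult.assoc[symmetric])
    then show ?thesis by (rule that)
  qed
qed

text \<open>Numerator and sine both change sign. Where the sine vanishes, the limit values agree
  because \<open>cos (2 * x) = cos (2 * y)\<close> there.\<close>

lemma W_sym: "W x y = W y x"
proof -
  have c: "cos (y - x) = cos (x - y)" and sn: "sin (y - x) = - sin (x - y)"
    using cos_minus[of "x - y"] sin_minus[of "x - y"] by auto
  have "cos (2 * x) - cos (2 * y) = 2 * sin (x + y) * sin (y - x)"
    using cos_diff_cos[of "2 * x" "2 * y"] by (simp add: add_divide_distrib diff_divide_distrib)
  then have "sin (x - y) = 0 \<Longrightarrow> cos (2 * x) = cos (2 * y)" using sn by simp
  then show ?thesis
    unfolding W_def c sn by (auto simp: N_def Nx_def A2_def field_simps)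
qed

lemma N_antisym: "N y x = - N x y"
  by (simp add: N_def)

lemma W_eq: "sin (x - y) \<noteq> 0 \<Longrightarrow> W x y = N x y / sin (x - y)"
  by (simp add: W_def)

text \<open>If the sine vanishes, then \<open>x = y + k * pi\<close>, and up to a power of
  \<open>s\<close> the numerator is \<open>N y y = 0\<close>. Here semiperiodicity keeps the
  quotient free of poles off the diagonal.\<close>

lemma sin_W: "sin (x - y) * W x y = N x y"
proof (cases "sin (x - y) = 0")
  case True
  then obtain k :: int where k: "x - y = of_int k * pi" using sin_zero_iff_int2 by blast
  have "N (y + of_int k * pi) y = 0"
  proof -
    have n: "N (u + real n * pi) v = s ^ n * N u v" for n u v
    proof (induction n)
      case (Suc n)
      have "u + real (Suc n) * pi = (u + real n * pi) + pi" by (simp add: algebra_simps)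
      moreover have "N (w + pi) v = s * N w v" for w
        unfolding N_def shift_A shift_A' by (simp add: algebra_simps)
      ultimately show ?case using Suc by (simp only: power_Suc mult.assoc)
    qed simp
    show ?thesis
    proof (cases "k \<ge> 0")
      case True
      then show ?thesis using n[of y "nat k" y] by (simp add: N_def)
    next
      case False
      then show ?thesis using n[of "y + of_int k * pi" "nat (- k)" y] sgn by (auto simp: N_def)
    qed
  qed
  moreover have "x = y + of_int k * pi" using k by simp
  ultimately show ?thesis using True by simp
qed (simp add: W_def)

text \<open>Near the diagonal \<open>W\<close> is \<open>Q / S\<close>, where \<open>Q\<close> and
  \<open>S\<close> extend \<open>N x y / (x - y)\<close> and \<open>sin u / u\<close>. The terms
  \<open>0 +\<close> and \<open>- 0\<close> make \<open>S\<close> a literal instance of the Hadamard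
  integral with base point 0.\<close>

definition Q where "Q x y = integral {0..1} (\<lambda>t. Nx (y + t * (x - y)) y)"
definition Qx where "Qx x y = integral {0..1} (\<lambda>t. t * Nxx (y + t * (x - y)) y)"
definition S where "S u = integral {0..1} (\<lambda>t. cos (0 + t * (u - 0)))" for u :: real
definition S' where "S' u = integral {0..1} (\<lambda>t. t * - sin (0 + t * (u - 0)))" for u :: real

lemma cont_Nxx: "continuous_on UNIV (\<lambda>x. Nxx x y)"
  unfolding Nxx_def A2_def A3_def by (intro continuous_intros)

lemma Q_eq: "(x - y) * Q x y = N x y"
  using hadamard_quotient_eq[OF deriv_N, of x y y]
  unfolding Q_def by (simp add: N_def)

lemma deriv_Q: "((\<lambda>x. Q x y) has_real_derivative Qx x y) (at x)"
  using hadamard_quotient_deriv[OF deriv_Nx cont_Nxx, of y y x]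
  unfolding Q_def Qx_def .

lemma S_eq: "u * S u = sin u"
  and deriv_S: "(S has_real_derivative S' u) (at u)"
proof -
  have c: "continuous_on UNIV (\<lambda>x::real. - sin x)" by (intro continuous_intros)
  show "u * S u = sin u" "(S has_real_derivative S' u) (at u)"
    using hadamard_quotient_eq[OF DERIV_sin, of u 0]
      hadamard_quotient_deriv[OF DERIV_cos c, of 0 u]
    unfolding S_def[abs_def] S'_def by simp_all
qed

lemma S_nonzero: "\<bar>u\<bar> < pi \<Longrightarrow> S u \<noteq> 0"
  using S_eq[of u] sin_eq_0_pi[of u] abs_less_iff[of u pi] by (cases "u = 0") (auto simp: S_def)

lemma W_strip: "\<bar>x - y\<bar> < pi \<Longrightarrow> W x y = Q x y / S (x - y)"
proof (cases "x = y")
  case True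
  then show ?thesis by (simp add: W_def Q_def S_def)
next
  case False
  assume xy: "\<bar>x - y\<bar> < pi"
  then have "sin (x - y) \<noteq> 0" using False sin_eq_0_pi[of "x - y"] abs_less_iff[of "x - y" pi] by auto
  then show ?thesis
    unfolding W_def Q_eq[symmetric] S_eq[symmetric] using False by simp
qed

definition Ws where "Ws x y = (Qx x y * S (x - y) - Q x y * S' (x - y)) / (S (x - y) * S (x - y))"

lemma deriv_W_strip:
  assumes "\<bar>x - y\<bar> < pi"
  shows "((\<lambda>x. W x y) has_real_derivative Ws x y) (at x)"
proof -
  have "((\<lambda>x. S (x - y)) has_real_derivative S' (x - y) * 1) (at x)"
    by (rule DERIV_chain2[OF deriv_S]) (auto intro!: derivative_eq_intros)
  then have "((\<lambda>x. Q x y / S (x - y)) has_real_derivative Ws x y) (at x)"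
    unfolding Ws_def by (intro DERIV_divide deriv_Q S_nonzero[OF assms]) simp
  then show ?thesis
    by (rule has_field_derivative_transform_within_open[of _ _ _ "{y - pi<..<y + pi}"])
      (use assms W_strip in auto)
qed

lemma cont_Ws: "continuous_on {p. \<bar>fst p - snd p\<bar> < pi} (\<lambda>p. Ws (fst p) (snd p))"
proof -
  have Q: "continuous_on UNIV (\<lambda>p::real\<times>real. Q (fst p) (snd p))"
    unfolding Q_def box_real(2)[symmetric] Nx_def A2_def
    by (intro integral_continuous_on_param) (unfold case_prod_beta, intro continuous_intros)
  have Qx: "continuous_on UNIV (\<lambda>p::real\<times>real. Qx (fst p) (snd p))"
    unfolding Qx_def box_real(2)[symmetric] Nxx_def A2_def A3_def
    by (intro integral_continuous_on_param) (unfold case_prod_beta, intro continuous_intros)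
  have S: "continuous_on UNIV (\<lambda>p::real\<times>real. S (fst p - snd p))"
    unfolding S_def box_real(2)[symmetric]
    by (intro integral_continuous_on_param) (unfold case_prod_beta, intro continuous_intros)
  have S': "continuous_on UNIV (\<lambda>p::real\<times>real. S' (fst p - snd p))"
    unfolding S'_def box_real(2)[symmetric]
    by (intro integral_continuous_on_param) (unfold case_prod_beta, intro continuous_intros)
  show ?thesis unfolding Ws_def
    by (intro continuous_intros continuous_on_subset[OF Q] continuous_on_subset[OF Qx]
        continuous_on_subset[OF S] continuous_on_subset[OF S']) (simp_all add: S_nonzero)
qed

section \<open>Regularity of the kernel on the whole plane\<close>

lemma strip_translate: "\<exists>k::int. \<bar>x - of_int k * pi - y\<bar> < pi"
proof -
  \<comment> \<open>With this floor as \<open>k\<close>, the translated difference lies in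
    \<open>[0, pi)\<close>.\<close>
  have "of_int \<lfloor>(x - y) / pi\<rfloor> \<le> (x - y) / pi" "(x - y) / pi < of_int \<lfloor>(x - y) / pi\<rfloor> + 1"
    by linarith+
  then have "\<bar>x - of_int \<lfloor>(x - y) / pi\<rfloor> * pi - y\<bar> < pi"
    unfolding pos_le_divide_eq[OF pi_gt_zero] pos_divide_less_eq[OF pi_gt_zero] distrib_right abs_less_iff
    using pi_gt_zero by linarith
  then show ?thesis by blast
qed

lemma W_translate_deriv:
  assumes "((\<lambda>x. W x y) has_real_derivative D) (at (x - a))"
  shows "((\<lambda>x. c * W (x - a) y) has_real_derivative c * D) (at x)"
  using DERIV_cmult[of "\<lambda>x. W (x - a) y" D x UNIV c] assms
    DERIV_shift[of "\<lambda>x. W x y" D x "- a"] by simp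

lemma deriv_W: "((\<lambda>x. W x y) has_real_derivative Wx x y) (at x)"
proof -
  obtain k :: int where k: "\<bar>x - of_int k * pi - y\<bar> < pi" using strip_translate by blast
  obtain c where c: "\<And>x y. W x y = c * W (x - of_int k * pi) y" by (rule W_shift_int[of k]) (rule that)
  have "((\<lambda>x. W x y) has_real_derivative c * Ws (x - of_int k * pi) y) (at x)"
    using W_translate_deriv[OF deriv_W_strip[OF k], of c] by (simp only: c[symmetric])
  then show ?thesis unfolding Wx_def by (simp only: DERIV_imp_deriv)
qed

lemma cont_Wx_UNIV: "continuous_on UNIV (\<lambda>p. Wx (fst p) (snd p))"
proof (rule continuous_at_imp_continuous_on, rule ballI)
  fix p :: "real \<times> real"
  obtain k :: int where k: "\<bar>fst p - of_int k * pi - snd p\<bar> < pi" using strip_translate by blast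
  obtain c where c: "\<And>x y. W x y = c * W (x - of_int k * pi) y" by (rule W_shift_int[of k]) (rule that)
  have Wxc: "Wx x y = c * Wx (x - of_int k * pi) y" for x y
    using W_translate_deriv[where a = "of_int k * pi" and c = c, OF deriv_W, of y x]
    unfolding c[symmetric] by (rule DERIV_unique[OF deriv_W])
  have strip: "open {p::real\<times>real. \<bar>fst p - snd p\<bar> < pi}"
    by (intro open_Collect_less continuous_intros)
  have "continuous_on {p. \<bar>fst p - snd p\<bar> < pi} (\<lambda>p. Wx (fst p) (snd p))"
  proof (rule continuous_on_eq[OF cont_Ws])
    fix p :: "real \<times> real" assume "p \<in> {p. \<bar>fst p - snd p\<bar> < pi}"
    then show "Ws (fst p) (snd p) = Wx (fst p) (snd p)"
      using DERIV_unique[OF deriv_W_strip deriv_W] by simp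
  qed
  then have 1: "isCont (\<lambda>p. Wx (fst p) (snd p)) (fst p - of_int k * pi, snd p)"
    using k strip by (simp add: continuous_on_eq_continuous_at)
  have 2: "isCont (\<lambda>p. (fst p - of_int k * pi, snd p)) p"
    by (intro continuous_intros)
  have "isCont (\<lambda>p. Wx (fst p - of_int k * pi) (snd p)) p"
    using isCont_o2[where f = "\<lambda>p. (fst p - of_int k * pi, snd p)" and g = "\<lambda>p. Wx (fst p) (snd p)", OF 2 1]
    by simp
  then have "isCont (\<lambda>p. c * Wx (fst p - of_int k * pi) (snd p)) p"
    by (rule continuous_mult_left)
  then show "isCont (\<lambda>p. Wx (fst p) (snd p)) p" by (simp only: Wxc[symmetric])
qed

lemma cont_Wx [continuous_intros]:
  "continuous_on T f \<Longrightarrow> continuous_on T g \<Longrightarrow> continuous_on T (\<lambda>x. Wx (f x) (g x))"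
  using continuous_on_compose2[OF cont_Wx_UNIV, of T "\<lambda>x. (f x, g x)"]
  by (simp add: continuous_on_Pair)

lemma deriv_W_snd: "(W x has_real_derivative Wx y x) (at y)"
proof -
  have "(\<lambda>y. W y x) = W x" using W_sym by auto
  then show ?thesis using deriv_W[of x y] by simp
qed

definition W' :: "real \<times> real \<Rightarrow> (real \<times> real) \<Rightarrow>\<^sub>L real" where
  "W' p = Wx (fst p) (snd p) *\<^sub>R fst_blinfun + Wx (snd p) (fst p) *\<^sub>R snd_blinfun"

text \<open>Both partial derivatives exist and the one in the second variable is jointly continuous,
  which yields total differentiability.\<close>

lemma has_derivative_W: "((\<lambda>p. W (fst p) (snd p)) has_derivative blinfun_apply (W' p)) (at p)"
proof -
  obtain x y where p: "p = (x, y)" by (cases p)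
  have "((\<lambda>(x, y). W x y) has_derivative (\<lambda>(tx, ty). Wx x y * tx + blinfun_mult_right (Wx y x) ty))
      (at (x, y) within UNIV \<times> UNIV)"
  proof (rule has_derivative_partialsI)
    show "((\<lambda>x. W x y) has_derivative (*) (Wx x y)) (at x within UNIV)"
      using deriv_W[of y x] by (simp add: has_field_derivative_def)
    show "(W a has_derivative blinfun_apply (blinfun_mult_right (Wx b a))) (at b within UNIV)" for a b
      using deriv_W_snd[of a b] by (simp add: has_field_derivative_def)
    have "continuous_on UNIV (\<lambda>p::real\<times>real. blinfun_mult_right (Wx (snd p) (fst p)))"
      by (intro bounded_linear.continuous_on[OF bounded_linear_blinfun_mult_right] continuous_intros)
    then show "continuous (at (x, y) within UNIV \<times> UNIV) (\<lambda>(x, y). blinfun_mult_right (Wx y x))"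
      unfolding case_prod_beta by (simp add: continuous_on_eq_continuous_at)
  qed auto
  then show ?thesis
    by (simp add: p W'_def case_prod_unfold plus_blinfun.rep_eq scaleR_blinfun.rep_eq)
qed

lemma C1_fun2_W: "C1_fun2 W"
  unfolding C1_fun2_def
proof (intro exI conjI allI)
  show "((\<lambda>p. W (fst p) (snd p)) has_derivative blinfun_apply (W' z)) (at z)" for z
    by (rule has_derivative_W)
  show "continuous_on UNIV W'" unfolding W'_def by (intro continuous_intros)
qed

lemma cont_W [continuous_intros]:
  "continuous_on T f \<Longrightarrow> continuous_on T g \<Longrightarrow> continuous_on T (\<lambda>x. W (f x) (g x))"
  using continuous_on_compose2[of UNIV "\<lambda>p. W (fst p) (snd p)" T "\<lambda>x. (f x, g x)"]
    has_derivative_continuous[OF has_derivative_W]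
  by (simp add: continuous_on_Pair continuous_at_imp_continuous_on)

lemma W_periodic: "W (x + 2 * pi) y = W x y" "W x (y + 2 * pi) = W x y"
proof -
  show 1: "W (x + 2 * pi) y = W x y" for x y
    using W_shift_pi[of "x + pi" y] W_shift_pi[of x y] sgn by (auto simp: add.assoc)
  show "W x (y + 2 * pi) = W x y" using 1[of y x] by (simp add: W_sym[of x])
qed

text \<open>The sum of the partial derivatives does not see \<open>sin (x - y)\<close>, so only the
  numerator is differentiated. There the products of \<open>A'\<close> and the terms with
  \<open>lam\<close> cancel, leaving \<open>alpha * (cos (2 * x) - cos (2 * y)) * A x * A y\<close>,
  which has the factor \<open>sin (x - y)\<close>.\<close>

lemma Wx_plus_Wy: "Wx x y + Wx y x = - 2 * alpha * sin (x + y) * A x * A y"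
proof -
  have generic: "Wx x y + Wx y x = - 2 * alpha * sin (x + y) * A x * A y" if "sin (x - y) \<noteq> 0" for x y
  proof -
    have Wx: "Wx x y = (Nx x y * sin (x - y) - N x y * cos (x - y)) / (sin (x - y) * sin (x - y))"
      if "sin (x - y) \<noteq> 0" for x y
    proof -
      have "((\<lambda>x. N x y / sin (x - y)) has_real_derivative
          (Nx x y * sin (x - y) - N x y * cos (x - y)) / (sin (x - y) * sin (x - y))) (at x)"
        by (rule derivative_eq_intros deriv_N refl that)+ simp
      moreover have "open {x. sin (x - y) \<noteq> 0}"
        by (intro open_Collect_neq continuous_intros)
      ultimately have "((\<lambda>x. W x y) has_real_derivative
          (Nx x y * sin (x - y) - N x y * cos (x - y)) / (sin (x - y) * sin (x - y))) (at x)"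
        by (rule has_field_derivative_transform_within_open) (use that W_eq in auto)
      then show ?thesis by (rule DERIV_unique[OF deriv_W])
    qed
    have c: "cos (y - x) = cos (x - y)" and sn: "sin (y - x) = - sin (x - y)"
      using cos_minus[of "x - y"] sin_minus[of "x - y"] by auto
    have "cos (2 * x) - cos (2 * y) = 2 * sin (x + y) * sin (y - x)"
      using cos_diff_cos[of "2 * x" "2 * y"] by (simp add: add_divide_distrib diff_divide_distrib)
    then have cc: "cos (2 * x) - cos (2 * y) = - 2 * sin (x + y) * sin (x - y)" using sn by simp
    have "Wx x y + Wx y x = (Nx x y - Nx y x) / sin (x - y)"
    proof -
      have "Wx x y = Nx x y / sin (x - y) - N x y * cos (x - y) / (sin (x - y) * sin (x - y))"
        using that Wx[of x y] by (simp add: diff_divide_distrib)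
      moreover have "Wx y x = - Nx y x / sin (x - y) + N x y * cos (x - y) / (sin (x - y) * sin (x - y))"
        using that Wx[of y x] sn c N_antisym[of x y] by (simp add: diff_divide_distrib)
      ultimately show ?thesis by (simp add: diff_divide_distrib)
    qed
    also have "Nx x y - Nx y x = - 2 * alpha * sin (x + y) * A x * A y * sin (x - y)"
    proof -
      have "Nx x y - Nx y x = alpha * (cos (2 * x) - cos (2 * y)) * A x * A y"
        by (simp add: Nx_def A2_def algebra_simps)
      then show ?thesis unfolding cc by (simp add: mult_ac)
    qed
    finally show ?thesis using that by simp
  qed
  show ?thesis
  proof (cases "sin (x - y) = 0")
    case True
    \<comment> \<open>The exceptional lines follow by continuity: \<open>sin (t - y)\<close> has no
      zero for \<open>t\<close> in the open interval from \<open>x\<close> to \<open>x + pi\<close>,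
      and \<open>x\<close> lies in its closure.\<close>
    define F where "F t = Wx t y + Wx y t + 2 * alpha * sin (t + y) * A t * A y" for t
    have "F x = 0"
    proof (rule continuous_constant_on_closure[of "{x<..<x + pi}" F 0 x])
      show "continuous_on (closure {x<..<x + pi}) F"
        unfolding F_def by (intro continuous_intros)
      show "x \<in> closure {x<..<x + pi}" by simp
      show "F t = 0" if "t \<in> {x<..<x + pi}" for t
      proof -
        have "sin (t - y) = sin (t - x) * cos (x - y)"
          using sin_add[of "t - x" "x - y"] True by simp
        moreover have "sin (t - x) \<noteq> 0" using that sin_gt_zero[of "t - x"] by auto
        moreover have "cos (x - y) \<noteq> 0" using True sin_cos_squared_add[of "x - y"] by auto
        ultimately show ?thesis unfolding F_def by (subst generic) auto
      qed
    qed
    then show ?thesis by (simp add: F_def)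
  qed (rule generic)
qed

end

section \<open>Integral operators with continuous kernels\<close>

text \<open>Fubini is needed for a product of completed measures. Completion does not change the
  measure of Borel sets, so a cover for \<open>lborel\<close> still works.\<close>

lemma sigma_finite_lebesgue: "sigma_finite_measure (lebesgue :: 'a::euclidean_space measure)"
proof
  obtain F :: "'a set set" where F: "countable F" "F \<subseteq> sets lborel" "\<Union>F = space lborel"
      "\<forall>a\<in>F. emeasure lborel a \<noteq> \<infinity>"
    using lborel.sigma_finite_countable by blast
  show "\<exists>F::'a set set. countable F \<and> F \<subseteq> sets lebesgue \<and> \<Union>F = space lebesgue \<and>
      (\<forall>a\<in>F. emeasure lebesgue a \<noteq> \<infinity>)"
  proof (intro exI[of _ F] conjI ballI)
    show "F \<subseteq> sets lebesgue" using F(2) by (blast intro: sets_completionI_sets)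
    show "emeasure lebesgue a \<noteq> \<infinity>" if "a \<in> F" for a
    proof -
      have "a \<in> sets lborel" using F(2) that by blast
      then have "emeasure lebesgue a = emeasure lborel a"
        by (simp only: emeasure_completion sets_completionI_sets main_part)
      then show ?thesis using F(4) that by simp
    qed
  qed (use F in simp_all)
qed

lemma pair_sigma_finite_lebesgue:
  "pair_sigma_finite (lebesgue :: 'a::euclidean_space measure) (lebesgue :: 'b::euclidean_space measure)"
  by (intro pair_sigma_finite.intro sigma_finite_lebesgue)

text \<open>Measurability for the product of the completions is obtained by factoring through the
  Borel sets of the plane, via the identity from \<open>lebesgue\<close> to \<open>borel\<close> in
  each coordinate.\<close>

lemma measurable_lebesgue_pair:
  assumes "continuous_on UNIV (\<lambda>p::real\<times>real. K (fst p) (snd p))"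
  shows "(\<lambda>p. K (fst p) (snd p) :: real) \<in> borel_measurable (lebesgue \<Otimes>\<^sub>M lebesgue)"
proof -
  have id: "(\<lambda>x. x) \<in> lebesgue \<rightarrow>\<^sub>M (borel :: real measure)"
    by (intro measurable_completion) simp
  have "(\<lambda>p. (fst p, snd p)) \<in> lebesgue \<Otimes>\<^sub>M lebesgue \<rightarrow>\<^sub>M (borel \<Otimes>\<^sub>M borel :: (real \<times> real) measure)"
    by (intro measurable_Pair measurable_compose[OF measurable_fst id] measurable_compose[OF measurable_snd id])
  then have "(\<lambda>p. (fst p, snd p)) \<in> lebesgue \<Otimes>\<^sub>M lebesgue \<rightarrow>\<^sub>M (borel :: (real \<times> real) measure)"
    by (simp add: borel_prod)
  from measurable_compose[OF this borel_measurable_continuous_onI[OF assms]]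
  show ?thesis by simp
qed

lemma L2_imp_integrable:
  assumes "L2 f"
  shows "set_integrable lebesgue {0..2*pi} f"
proof -
  have "set_integrable lebesgue {0..2*pi} (\<lambda>x. 1 + (f x)\<^sup>2)"
  proof (rule set_integral_add(1))
    show "set_integrable lebesgue {0..2*pi} (\<lambda>x. (f x)\<^sup>2)" using assms by (simp add: L2_def)
    show "set_integrable lebesgue {0..2*pi} (\<lambda>_. 1::real)"
      by (intro absolutely_integrable_continuous_real continuous_intros)
  qed
  moreover have "\<bar>f x\<bar> \<le> \<bar>1 + (f x)\<^sup>2\<bar>" for x
  proof -
    \<comment> \<open>The first square gives \<open>2 |f x| \<le> 1 + (f x)^2\<close>.\<close>
    have "0 \<le> (\<bar>f x\<bar> - 1)\<^sup>2" "0 \<le> (f x)\<^sup>2" by simp_all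
    then show ?thesis by (simp add: power2_eq_square algebra_simps)
  qed
  moreover have "(\<lambda>x. indicator {0..2*pi} x *\<^sub>R f x) \<in> borel_measurable lebesgue"
    using assms by (simp add: L2_def set_borel_measurable_def)
  ultimately show ?thesis
    unfolding set_integrable_def
    by (elim Bochner_Integration.integrable_bound) (simp_all add: indicator_def)
qed

lemma continuous_imp_set_integrable:
  "continuous_on UNIV (h :: real \<Rightarrow> real) \<Longrightarrow> set_integrable lebesgue {a..b} h"
  by (intro absolutely_integrable_continuous_real) (auto intro: continuous_on_subset)

lemma continuous_imp_L2:
  assumes "continuous_on UNIV h"
  shows "L2 h"
  unfolding L2_def
proof
  show "set_borel_measurable lebesgue {0..2*pi} h"
    using continuous_imp_set_integrable[OF assms]
    unfolding set_integrable_def set_borel_measurable_def by blast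
  show "set_integrable lebesgue {0..2*pi} (\<lambda>x. (h x)\<^sup>2)"
    using assms by (intro continuous_imp_set_integrable continuous_intros)
qed

locale continuous_kernel =
  fixes K :: "real \<Rightarrow> real \<Rightarrow> real"
  assumes cont_K: "continuous_on UNIV (\<lambda>p. K (fst p) (snd p))"
begin

lemma cont_K_compose:
  "continuous_on T f \<Longrightarrow> continuous_on T g \<Longrightarrow> continuous_on T (\<lambda>x. K (f x) (g x))"
  using continuous_on_compose2[OF cont_K, of T "\<lambda>x. (f x, g x)"]
  by (simp add: continuous_on_Pair)

lemma K_bound:
  obtains C where "C \<ge> 0" "\<And>x y. x \<in> {a..b} \<Longrightarrow> y \<in> {c..d} \<Longrightarrow> \<bar>K x y\<bar> \<le> C"
proof -
  have "compact ((\<lambda>p. K (fst p) (snd p)) ` ({a..b} \<times> {c..d}))"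
    by (intro compact_continuous_image compact_Times compact_Icc continuous_on_subset[OF cont_K]) auto
  then obtain C where C: "\<forall>z\<in>(\<lambda>p. K (fst p) (snd p)) ` ({a..b} \<times> {c..d}). norm z \<le> C"
    by (auto dest!: compact_imp_bounded simp: bounded_iff)
  show ?thesis
  proof (rule that[of "max C 0"])
    fix x y assume "x \<in> {a..b}" "y \<in> {c..d}"
    then have "norm (K x y) \<le> C" using C by (auto simp: image_iff)
    then show "\<bar>K x y\<bar> \<le> max C 0" by simp
  qed simp
qed

lemma hilbert_schmidt: "hilbert_schmidt_kernel K"
proof -
  let ?M = "lebesgue \<Otimes>\<^sub>M lebesgue :: (real \<times> real) measure"
  let ?I = "{0..2*pi} \<times> {0..2*pi}"
  note meas [measurable] = measurable_lebesgue_pair[OF cont_K]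
  have I: "?I \<in> sets ?M" by (intro pair_measureI) auto
  note I [measurable]
  have fin: "emeasure ?M ?I < \<infinity>"
    by (subst sigma_finite_measure.emeasure_pair_measure_Times[OF sigma_finite_lebesgue])
      (auto simp: ennreal_mult_less_top)
  obtain C where C: "\<And>x y. x \<in> {0..2*pi} \<Longrightarrow> y \<in> {0..2*pi} \<Longrightarrow> \<bar>K x y\<bar> \<le> C"
    using K_bound[of 0 "2*pi" 0 "2*pi"] by blast
  have "set_borel_measurable ?M ?I (\<lambda>(x, y). K x y)"
    unfolding set_borel_measurable_def case_prod_beta by measurable
  moreover have "set_integrable ?M ?I (\<lambda>(x, y). (K x y)\<^sup>2)"
    unfolding set_integrable_def case_prod_beta
  proof (rule integrableI_bounded_set[where A = ?I and B = "C\<^sup>2"])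
    show "AE p in ?M. p \<in> ?I \<longrightarrow> norm (indicator ?I p *\<^sub>R (K (fst p) (snd p))\<^sup>2) \<le> C\<^sup>2"
    proof (intro AE_I2 impI)
      fix p :: "real \<times> real" assume "p \<in> ?I"
      then have "\<bar>K (fst p) (snd p)\<bar> \<le> \<bar>C\<bar>" using C[of "fst p" "snd p"] by (auto simp: mem_Times_iff)
      then have "(K (fst p) (snd p))\<^sup>2 \<le> C\<^sup>2" by (simp only: abs_le_square_iff)
      then show "norm (indicator ?I p *\<^sub>R (K (fst p) (snd p))\<^sup>2) \<le> C\<^sup>2"
        using \<open>p \<in> ?I\<close> by simp
    qed
    show "(\<lambda>p. indicator ?I p *\<^sub>R (K (fst p) (snd p))\<^sup>2) \<in> borel_measurable ?M" by measurable
  qed (use I fin in simp_all)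
  ultimately show ?thesis unfolding hilbert_schmidt_kernel_def by blast
qed

text \<open>Fubini and symmetry. The restriction to the interval is absorbed into \<open>F\<close>
  and \<open>G\<close>, and a bound \<open>C\<close> of the kernel on the square gives the
  integrable majorant \<open>C * |G x * F y|\<close>.\<close>

lemma self_adjoint:
  assumes sym: "\<And>x y. K x y = K y x"
  shows "self_adjoint_kernel K"
  unfolding self_adjoint_kernel_def
proof (intro allI impI)
  fix f g assume fg: "L2 f \<and> L2 g"
  let ?L = "lebesgue :: real measure"
  interpret pair_sigma_finite ?L ?L
    by (rule pair_sigma_finite_lebesgue)
  define F where "F x = indicator {0..2*pi} x * f x" for x
  define G where "G x = indicator {0..2*pi} x * g x" for x
  have F: "integrable ?L F" and G: "integrable ?L G"
    using fg[THEN conjunct1, THEN L2_imp_integrable] fg[THEN conjunct2, THEN L2_imp_integrable]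
    by (simp_all add: set_integrable_def F_def[abs_def] G_def[abs_def])
  note [measurable] = borel_measurable_integrable[OF F] borel_measurable_integrable[OF G]
    measurable_lebesgue_pair[OF cont_K]
  obtain C where C: "C \<ge> 0" "\<And>x y. x \<in> {0..2*pi} \<Longrightarrow> y \<in> {0..2*pi} \<Longrightarrow> \<bar>K x y\<bar> \<le> C"
    using K_bound[of 0 "2*pi" 0 "2*pi"] by blast
  have FG: "integrable (?L \<Otimes>\<^sub>M ?L) (\<lambda>p. G (fst p) * F (snd p))"
  proof (rule Fubini_integrable)
    show "integrable ?L (\<lambda>x. LINT y|?L. norm (G (fst (x, y)) * F (snd (x, y))))"
      using F G by (simp add: abs_mult)
  qed (use F G in auto)
  have "integrable (?L \<Otimes>\<^sub>M ?L) (\<lambda>p. K (fst p) (snd p) * (G (fst p) * F (snd p)))"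
  proof (rule Bochner_Integration.integrable_bound[OF integrable_mult_right[OF FG, of C]])
    have "\<bar>K x y * (G x * F y)\<bar> \<le> \<bar>C * (G x * F y)\<bar>" for x y
    proof (cases "x \<in> {0..2*pi} \<and> y \<in> {0..2*pi}")
      case True
      then show ?thesis using C by (simp add: abs_mult mult_right_mono)
    qed (auto simp: F_def G_def indicator_def)
    then show "AE p in ?L \<Otimes>\<^sub>M ?L. norm (K (fst p) (snd p) * (G (fst p) * F (snd p)))
        \<le> norm (C * (G (fst p) * F (snd p)))"
      by (intro AE_I2) simp
  qed measurable
  then have "integrable (?L \<Otimes>\<^sub>M ?L) (\<lambda>(x, y). K x y * (G x * F y))"
    by (simp add: case_prod_unfold)
  from Fubini_integral[OF this]
  have eq: "(LINT y|?L. LINT x|?L. K x y * (G x * F y)) = (LINT x|?L. LINT y|?L. K x y * (G x * F y))" .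
  have iF: "int_op K f x = (LINT y|?L. K x y * F y)" for x
    by (simp add: int_op_def set_lebesgue_integral_def F_def mult_ac)
  have iG: "int_op K g x = (LINT y|?L. K x y * G y)" for x
    by (simp add: int_op_def set_lebesgue_integral_def G_def mult_ac)
  have "(LINT x:{0..2*pi}|?L. int_op K f x * g x) = (LINT x|?L. G x * (LINT y|?L. K x y * F y))"
    by (simp add: set_lebesgue_integral_def G_def iF mult_ac)
  also have "\<dots> = (LINT x|?L. LINT y|?L. K x y * (G x * F y))"
    by (simp only: mult.left_commute[of "K _ _"] integral_mult_right_zero)
  also have "\<dots> = (LINT y|?L. LINT x|?L. K x y * (G x * F y))" by (rule eq[symmetric])
  also have "\<dots> = (LINT y|?L. F y * (LINT x|?L. K y x * G x))"
  proof -
    have "K x y * (G x * F y) = F y * (K y x * G x)" for x y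
      by (subst sym) (simp add: mult_ac)
    then show ?thesis by (simp only: integral_mult_right_zero)
  qed
  also have "\<dots> = (LINT x:{0..2*pi}|?L. f x * int_op K g x)"
    by (simp add: set_lebesgue_integral_def F_def iG mult_ac)
  finally show "(LINT x:{0..2*pi}|?L. int_op K f x * g x) = (LINT x:{0..2*pi}|?L. f x * int_op K g x)" .
qed

text \<open>Dominated convergence along a sequence: a convergent sequence stays in some
  \<open>[-B, B]\<close>, where the kernel is bounded by \<open>C\<close>, and
  \<open>C * |f|\<close> is the majorant. It supplies the continuous representative of an
  eigenfunction.\<close>

lemma cont_int_op:
  assumes "L2 f"
  shows "continuous_on UNIV (int_op K f)"
proof (rule continuous_on_sequentiallyI)
  fix u :: "nat \<Rightarrow> real" and a
  assume u: "u \<longlonglongrightarrow> a"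
  let ?I = "{0..2*pi}"
  have F: "integrable lebesgue (\<lambda>y. indicator ?I y * f y)"
    using L2_imp_integrable[OF assms] by (simp add: set_integrable_def)
  obtain B where B: "\<And>n. \<bar>u n\<bar> \<le> B"
    using convergent_imp_Bseq[OF convergentI[OF u]] by (auto simp: Bseq_def)
  obtain C where C: "C \<ge> 0" "\<And>x y. x \<in> {-B..B} \<Longrightarrow> y \<in> ?I \<Longrightarrow> \<bar>K x y\<bar> \<le> C"
    using K_bound[of "-B" B 0 "2*pi"] by blast
  have K: "(\<lambda>y. K x y) \<in> borel_measurable lebesgue" for x
    by (intro measurable_completion)
      (simp add: borel_measurable_continuous_onI cont_K_compose continuous_intros)
  have "(\<lambda>n. LINT y|lebesgue. K (u n) y * (indicator ?I y * f y)) \<longlonglongrightarrow>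
      (LINT y|lebesgue. K a y * (indicator ?I y * f y))"
  proof (rule integral_dominated_convergence[where w = "\<lambda>y. C * \<bar>indicator ?I y * f y\<bar>"])
    show "integrable lebesgue (\<lambda>y. C * \<bar>indicator ?I y * f y\<bar>)" using F by auto
    show "AE y in lebesgue. (\<lambda>n. K (u n) y * (indicator ?I y * f y)) \<longlonglongrightarrow> K a y * (indicator ?I y * f y)"
    proof (rule AE_I2)
      fix y
      have "continuous_on UNIV (\<lambda>x. K x y)" by (intro cont_K_compose continuous_intros)
      then have "isCont (\<lambda>x. K x y) a" by (simp add: continuous_on_eq_continuous_at)
      from isCont_tendsto_compose[OF this u]
      show "(\<lambda>n. K (u n) y * (indicator ?I y * f y)) \<longlonglongrightarrow> K a y * (indicator ?I y * f y)"
        by (intro tendsto_intros)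
    qed
    show "AE y in lebesgue. norm (K (u n) y * (indicator ?I y * f y)) \<le> C * \<bar>indicator ?I y * f y\<bar>" for n
    proof (rule AE_I2)
      fix y
      have "u n \<in> {-B..B}" using B[of n] by (auto simp: abs_le_iff)
      then show "norm (K (u n) y * (indicator ?I y * f y)) \<le> C * \<bar>indicator ?I y * f y\<bar>"
        using C by (auto simp: indicator_def abs_mult intro!: mult_right_mono)
    qed
  qed (use K borel_measurable_integrable[OF F] in \<open>auto intro!: borel_measurable_times\<close>)
  then show "(\<lambda>n. int_op K f (u n)) \<longlonglongrightarrow> int_op K f a"
    by (simp add: int_op_def set_lebesgue_integral_def mult_ac)
qed

lemma int_op_eq_integral:
  assumes "continuous_on UNIV h"
  shows "int_op K h x = integral {0..2*pi} (\<lambda>y. K x y * h y)"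
  unfolding int_op_def
  by (intro set_lebesgue_integral_eq_integral(2) continuous_imp_set_integrable
      continuous_intros cont_K_compose assms)

end

text \<open>Inside the interval the set where \<open>u\<close> is nonzero is open and null, hence
  empty; closure adds the endpoints and periodicity the rest. This turns almost-everywhere
  proportionality into a pointwise differential equation.\<close>

lemma AE_zero_imp_zero:
  fixes u :: "real \<Rightarrow> real"
  assumes u: "continuous_on UNIV u" and per: "periodic2pi u"
    and ae: "AE x in lebesgue. x \<in> {0..2*pi} \<longrightarrow> u x = 0"
  shows "u x = 0"
proof -
  define V where "V = {0<..<2*pi} \<inter> {x. u x \<noteq> 0}"
  have "open V"
    unfolding V_def by (intro open_Int open_Collect_neq u continuous_intros open_greaterThanLessThan)
  moreover have "negligible V"
  proof -
    have "AE x in lebesgue. x \<notin> V" using ae by (rule eventually_mono) (auto simp: V_def)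
    moreover have "V \<in> sets lebesgue" using \<open>open V\<close> by (simp add: borel_open sets_completionI_sets)
    ultimately show ?thesis
      by (simp add: negligible_iff_null_sets AE_iff_null_sets)
  qed
  ultimately have "V = {}" using open_not_negligible by blast
  then have "u t = 0" if "t \<in> {0<..<2*pi}" for t using that by (auto simp: V_def)
  then have I: "u t = 0" if "t \<in> {0..2*pi}" for t
    using continuous_constant_on_closure[of "{0<..<2*pi}" u 0 t] that continuous_on_subset[OF u] by auto
  interpret periodic_fun_simple u "2 * pi" using per by unfold_locales (simp add: periodic2pi_def)
  define k where "k = \<lfloor>x / (2 * pi)\<rfloor>"
  have "of_int k \<le> x / (2 * pi)" "x / (2 * pi) < of_int k + 1" unfolding k_def by linarith+
  then have "x - of_int k * (2 * pi) \<in> {0..2*pi}"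
    by (simp add: pos_le_divide_eq pos_divide_less_eq distrib_right)
  from I[OF this] show ?thesis by (simp add: minus_of_int)
qed

section \<open>Commutation with the Mathieu operator\<close>

lemma integral_cmult_real: "integral S (\<lambda>x. c * f x) = c * integral S f" for c :: real
  using integral_cmul[of S c f] by simp

lemma integral_diff_cont:
  fixes f g :: "real \<Rightarrow> real"
  assumes "continuous_on UNIV f" "continuous_on UNIV g"
  shows "integral {a..b} (\<lambda>x. f x - g x) = integral {a..b} f - integral {a..b} g"
  using assms by (intro integral_diff integrable_continuous_real) (auto intro: continuous_on_subset)

lemma integral_add_cont:
  fixes f g :: "real \<Rightarrow> real"
  assumes "continuous_on UNIV f" "continuous_on UNIV g"
  shows "integral {a..b} (\<lambda>x. f x + g x) = integral {a..b} f + integral {a..b} g"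
  using assms by (intro integral_add integrable_continuous_real) (auto intro: continuous_on_subset)

lemma integral_deriv_periodic:
  fixes F F' :: "real \<Rightarrow> real"
  assumes "\<And>x. (F has_real_derivative F' x) (at x)" "F (2 * pi) = F 0"
  shows "integral {0..2*pi} F' = 0"
proof -
  have "(F' has_integral (F (2 * pi) - F 0)) {0..2*pi}"
    using assms(1) by (intro fundamental_theorem_of_calculus)
      (auto simp: has_real_derivative_iff_has_vector_derivative[symmetric]
        intro: has_field_derivative_at_within)
  then show ?thesis using assms(2) by (simp add: integral_unique)
qed

lemma integral_param_deriv:
  fixes f fx :: "real \<Rightarrow> real \<Rightarrow> real"
  assumes "\<And>x y. ((\<lambda>x. f x y) has_real_derivative fx x y) (at x)"
    and "\<And>x. continuous_on UNIV (f x)"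
    and "continuous_on UNIV (\<lambda>p. fx (fst p) (snd p))"
  shows "((\<lambda>x. integral {a..b} (f x)) has_real_derivative integral {a..b} (fx x)) (at x)"
proof -
  have "((\<lambda>x. integral (cbox a b) (f x)) has_real_derivative integral (cbox a b) (fx x)) (at x within UNIV)"
  proof (rule leibniz_rule_field_derivative)
    show "((\<lambda>x. f x t) has_real_derivative fx x t) (at x within UNIV)" for x t
      using assms(1) by simp
    show "f x integrable_on cbox a b" for x
      by (intro integrable_continuous continuous_on_subset[OF assms(2)]) simp
    show "continuous_on (UNIV \<times> cbox a b) (\<lambda>(x, t). fx x t)"
      unfolding case_prod_beta by (intro continuous_on_subset[OF assms(3)]) simp
  qed auto
  then show ?thesis by simp
qed

lemma integral_param_cont:
  fixes f :: "real \<Rightarrow> real \<Rightarrow> real"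
  assumes "continuous_on UNIV (\<lambda>p. f (fst p) (snd p))"
  shows "continuous_on UNIV (\<lambda>x. integral {a..b} (f x))"
proof -
  have "continuous_on UNIV (\<lambda>x. integral (cbox a b) (f x))"
    by (rule integral_continuous_on_param, unfold case_prod_beta)
      (intro continuous_on_subset[OF assms], simp)
  then show ?thesis by simp
qed

lemma periodic_deriv:
  fixes g g' :: "real \<Rightarrow> real"
  assumes "\<And>x. (g has_real_derivative g' x) (at x)" "periodic2pi g"
  shows "periodic2pi g'"
  unfolding periodic2pi_def
proof
  fix x
  have "((\<lambda>x. g (x + 2 * pi)) has_real_derivative g' (x + 2 * pi)) (at x)"
    using assms(1)[of "x + 2 * pi"] by (simp only: DERIV_shift)
  moreover have "(\<lambda>x. g (x + 2 * pi)) = g" using assms(2) by (auto simp: periodic2pi_def)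
  ultimately show "g' (x + 2 * pi) = g' x" using DERIV_unique[OF assms(1)] by metis
qed

context semiperiodic_mathieu
begin

sublocale continuous_kernel W
  by unfold_locales (intro continuous_intros)

lemma A_2pi: "A (x + 2 * pi) = A x"
  using shift_A[of "x + pi"] shift_A[of x] sgn by (auto simp: add.assoc)

text \<open>On continuous functions this is \<open>int_op W\<close>, written with the gauge
  integral, the one in which parameter derivatives and the fundamental theorem are
  available.\<close>

definition T :: "(real \<Rightarrow> real) \<Rightarrow> real \<Rightarrow> real" where
  "T h x = integral {0..2*pi} (\<lambda>y. W x y * h y)"

text \<open>By \<open>Wx_plus_Wy\<close>, the kernel \<open>Wx x y + Wx y x\<close> sends
  \<open>h\<close> to \<open>- 2 * alpha * A x * R h x\<close>.\<close>

definition R :: "(real \<Rightarrow> real) \<Rightarrow> real \<Rightarrow> real" where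
  "R h x = integral {0..2*pi} (\<lambda>y. sin (x + y) * A y * h y)"

definition R' :: "(real \<Rightarrow> real) \<Rightarrow> real \<Rightarrow> real" where
  "R' h x = integral {0..2*pi} (\<lambda>y. cos (x + y) * A y * h y)"

lemma cont_compose: "continuous_on UNIV h \<Longrightarrow> continuous_on X f \<Longrightarrow> continuous_on X (\<lambda>x. h (f x))"
  for h :: "real \<Rightarrow> real"
  by (rule continuous_on_compose2) auto

lemma deriv_T:
  assumes "continuous_on UNIV h"
  shows "(T h has_real_derivative integral {0..2*pi} (\<lambda>y. Wx x y * h y)) (at x)"
  unfolding T_def[abs_def]
  by (rule integral_param_deriv) (intro DERIV_cmult_right deriv_W continuous_intros cont_compose[OF assms])+

lemma cont_deriv_T:
  assumes "continuous_on UNIV h"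
  shows "continuous_on UNIV (\<lambda>x. integral {0..2*pi} (\<lambda>y. Wx x y * h y))"
  by (rule integral_param_cont) (intro continuous_intros cont_compose[OF assms])

lemma deriv_R:
  assumes "continuous_on UNIV h"
  shows "(R h has_real_derivative R' h x) (at x)"
  unfolding R_def[abs_def] R'_def
proof (rule integral_param_deriv)
  show "((\<lambda>x. sin (x + y) * A y * h y) has_real_derivative cos (x + y) * A y * h y) (at x)" for x y
    by (rule derivative_eq_intros refl)+ simp
qed (intro continuous_intros cont_compose[OF assms])+

lemma cont_R:
  assumes "continuous_on UNIV h"
  shows "continuous_on UNIV (R h)"
  unfolding R_def[abs_def] by (rule integral_param_cont) (intro continuous_intros cont_compose[OF assms])

lemma cont_R':
  assumes "continuous_on UNIV h"
  shows "continuous_on UNIV (R' h)"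
  unfolding R'_def[abs_def] by (rule integral_param_cont) (intro continuous_intros cont_compose[OF assms])

text \<open>Since \<open>W\<^sub>x + W\<^sub>y\<close> is a degenerate smooth kernel, an integration by parts moves the derivative
  across the operator.\<close>

lemma deriv_T_by_parts:
  assumes h: "\<And>x. (h has_real_derivative h' x) (at x)" and h': "continuous_on UNIV h'"
    and per: "periodic2pi h"
  shows "integral {0..2*pi} (\<lambda>y. Wx x y * h y) = T h' x - 2 * alpha * A x * R h x"
proof -
  have ch: "continuous_on UNIV h"
    using h DERIV_isCont continuous_at_imp_continuous_on by blast
  note [continuous_intros] = cont_compose[OF ch] cont_compose[OF h']
  have "integral {0..2*pi} (\<lambda>y. Wx y x * h y + h' y * W x y) = 0"
  proof (rule integral_deriv_periodic)
    show "((\<lambda>y. W x y * h y) has_real_derivative Wx y x * h y + h' y * W x y) (at y)" for y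
      by (rule DERIV_mult[OF deriv_W_snd h])
    show "W x (2 * pi) * h (2 * pi) = W x 0 * h 0"
      using W_periodic(2)[of x 0] per[unfolded periodic2pi_def, rule_format, of 0] by simp
  qed
  moreover have "(\<lambda>y. Wx x y * h y) =
      (\<lambda>y. W x y * h' y - 2 * alpha * A x * (sin (x + y) * A y * h y) - (Wx y x * h y + h' y * W x y))"
  proof
    fix y
    have e: "Wx x y = - 2 * alpha * sin (x + y) * A x * A y - Wx y x"
      using Wx_plus_Wy[of x y] by simp
    show "Wx x y * h y = W x y * h' y - 2 * alpha * A x * (sin (x + y) * A y * h y)
        - (Wx y x * h y + h' y * W x y)"
      unfolding e by (simp add: algebra_simps)
  qed
  moreover have "integral {0..2*pi} (\<lambda>y. W x y * h' y - 2 * alpha * A x * (sin (x + y) * A y * h y)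
        - (Wx y x * h y + h' y * W x y)) =
      T h' x - 2 * alpha * A x * R h x - integral {0..2*pi} (\<lambda>y. Wx y x * h y + h' y * W x y)"
  proof -
    have "integral {0..2*pi} (\<lambda>y. W x y * h' y - 2 * alpha * A x * (sin (x + y) * A y * h y)) =
        T h' x - 2 * alpha * A x * R h x"
      unfolding T_def R_def integral_cmult_real[symmetric]
      by (intro integral_diff_cont continuous_intros)
    moreover have "integral {0..2*pi} (\<lambda>y. W x y * h' y - 2 * alpha * A x * (sin (x + y) * A y * h y)
          - (Wx y x * h y + h' y * W x y)) =
        integral {0..2*pi} (\<lambda>y. W x y * h' y - 2 * alpha * A x * (sin (x + y) * A y * h y))
        - integral {0..2*pi} (\<lambda>y. Wx y x * h y + h' y * W x y)"
      by (intro integral_diff_cont continuous_intros)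
    ultimately show ?thesis by simp
  qed
  ultimately show ?thesis by simp
qed

text \<open>Its \<open>R'\<close> term is there to cancel the one produced when \<open>R\<close> is
  differentiated for the second derivative of an eigenfunction.\<close>

lemma R_by_parts:
  assumes h: "\<And>x. (h has_real_derivative h' x) (at x)" and h': "continuous_on UNIV h'"
    and per: "periodic2pi h"
  shows "R h' x = - R' h x - integral {0..2*pi} (\<lambda>y. sin (x + y) * A' y * h y)"
proof -
  have ch: "continuous_on UNIV h"
    using h DERIV_isCont continuous_at_imp_continuous_on by blast
  note [continuous_intros] = cont_compose[OF ch] cont_compose[OF h']
  have "integral {0..2*pi} (\<lambda>y. (cos (x + y) * A y + sin (x + y) * A' y) * h y + sin (x + y) * A y * h' y) = 0"
  proof (rule integral_deriv_periodic)
    show "((\<lambda>y. sin (x + y) * A y * h y) has_real_derivative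
        (cos (x + y) * A y + sin (x + y) * A' y) * h y + sin (x + y) * A y * h' y) (at y)" for y
      by (rule derivative_eq_intros h refl)+ (simp add: algebra_simps)
    show "sin (x + 2 * pi) * A (2 * pi) * h (2 * pi) = sin (x + 0) * A 0 * h 0"
      using A_2pi[of 0] per[unfolded periodic2pi_def, rule_format, of 0] by simp
  qed
  also have "(\<lambda>y. (cos (x + y) * A y + sin (x + y) * A' y) * h y + sin (x + y) * A y * h' y) =
      (\<lambda>y. cos (x + y) * A y * h y + sin (x + y) * A' y * h y + sin (x + y) * A y * h' y)"
    by (simp add: algebra_simps)
  also have "integral {0..2*pi} \<dots> = R' h x + integral {0..2*pi} (\<lambda>y. sin (x + y) * A' y * h y) + R h' x"
  proof -
    have "integral {0..2*pi} (\<lambda>y. cos (x + y) * A y * h y + sin (x + y) * A' y * h y) =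
        R' h x + integral {0..2*pi} (\<lambda>y. sin (x + y) * A' y * h y)"
      unfolding R'_def by (intro integral_add_cont continuous_intros)
    moreover have "integral {0..2*pi} (\<lambda>y. cos (x + y) * A y * h y + sin (x + y) * A' y * h y
          + sin (x + y) * A y * h' y) =
        integral {0..2*pi} (\<lambda>y. cos (x + y) * A y * h y + sin (x + y) * A' y * h y) + R h' x"
      unfolding R_def by (intro integral_add_cont continuous_intros)
    ultimately show ?thesis by simp
  qed
  finally show ?thesis by simp
qed

text \<open>Bootstrap: \<open>g = T g / nu\<close> is C1 because \<open>T\<close> can be
  differentiated under the integral; integration by parts then expresses \<open>g'\<close> through
  \<open>T g'\<close> and \<open>R g\<close>, which are again differentiable.\<close>

lemma eigenfunction_smooth:
  assumes nu: "nu \<noteq> 0" and g: "continuous_on UNIV g" and per: "periodic2pi g"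
    and eig: "\<And>x. T g x = nu * g x"
  obtains g' g'' where "\<And>x. (g has_real_derivative g' x) (at x)"
    "\<And>x. (g' has_real_derivative g'' x) (at x)" "continuous_on UNIV g''"
    "\<And>x. T (\<lambda>y. g'' y + alpha * cos (2 * y) * g y) x = nu * (g'' x + alpha * cos (2 * x) * g x)"
proof -
  have g_eq: "g = (\<lambda>x. T g x / nu)" using eig nu by auto
  define g' where "g' x = integral {0..2*pi} (\<lambda>y. Wx x y * g y) / nu" for x
  have dg: "(g has_real_derivative g' x) (at x)" for x
    unfolding g'_def by (subst g_eq) (intro DERIV_cdivide deriv_T g)
  have cg': "continuous_on UNIV g'"
    unfolding g'_def[abs_def] by (intro continuous_intros cont_deriv_T g) (use nu in auto)
  have pg': "periodic2pi g'" by (rule periodic_deriv[OF dg per])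
  have g'_eq: "g' = (\<lambda>x. (T g' x - 2 * alpha * (A x * R g x)) / nu)"
  proof
    fix x
    show "g' x = (T g' x - 2 * alpha * (A x * R g x)) / nu"
      using deriv_T_by_parts[OF dg cg' per, of x] g'_def[of x] by (simp only: mult.assoc)
  qed
  define g'' where "g'' x = (integral {0..2*pi} (\<lambda>y. Wx x y * g' y)
      - 2 * alpha * (A' x * R g x + R' g x * A x)) / nu" for x
  have dg': "(g' has_real_derivative g'' x) (at x)" for x
    unfolding g''_def
    by (subst g'_eq) (intro DERIV_cdivide DERIV_diff DERIV_cmult DERIV_mult deriv_T cg' deriv_A deriv_R g)
  have cg'': "continuous_on UNIV g''"
    unfolding g''_def[abs_def]
    by (intro continuous_intros cont_deriv_T cg' cont_R cont_R' g) (use nu in auto)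
  note [continuous_intros] = cont_compose[OF g] cont_compose[OF cg'']
  have "T (\<lambda>y. g'' y + alpha * cos (2 * y) * g y) x = nu * (g'' x + alpha * cos (2 * x) * g x)" for x
  proof -
    let ?I = "{0..2*pi}"
    let ?J = "integral {0..2*pi}"
    have "nu * g'' x = T g'' x - 2 * alpha * A x * R g' x - 2 * alpha * (A' x * R g x + R' g x * A x)"
    proof -
      have "nu * g'' x = ?J (\<lambda>y. Wx x y * g' y) - 2 * alpha * (A' x * R g x + R' g x * A x)"
        unfolding g''_def using nu by simp
      then show ?thesis by (simp only: deriv_T_by_parts[OF dg' cg'' pg'])
    qed
    \<comment> \<open>The terms with \<open>R' g\<close> cancel; what remains has the kernel
      \<open>sin (x + y) * N x y\<close>.\<close>
    also have "\<dots> = T g'' x + 2 * alpha * (A x * ?J (\<lambda>y. sin (x + y) * A' y * g y) - A' x * R g x)"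
      unfolding R_by_parts[OF dg cg' per] by (simp add: algebra_simps)
    also have "A x * ?J (\<lambda>y. sin (x + y) * A' y * g y) - A' x * R g x =
        ?J (\<lambda>y. A x * (sin (x + y) * A' y * g y) - A' x * (sin (x + y) * A y * g y))"
      unfolding R_def integral_cmult_real[symmetric]
      by (intro integral_diff_cont[symmetric] continuous_intros)
    also have "(\<lambda>y. A x * (sin (x + y) * A' y * g y) - A' x * (sin (x + y) * A y * g y)) =
        (\<lambda>y. (cos (2 * y) * (W x y * g y) - cos (2 * x) * (W x y * g y)) / 2)"
    proof
      fix y
      have "A x * (sin (x + y) * A' y * g y) - A' x * (sin (x + y) * A y * g y) =
          sin (x + y) * N x y * g y" by (simp add: N_def algebra_simps)
      \<comment> \<open>Writing \<open>N\<close> as \<open>sin (x - y) * W\<close> brings back the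
        kernel, and the two sines become half the difference of the potentials at \<open>y\<close>
        and \<open>x\<close>.\<close>
      also have "\<dots> = (sin (x + y) * sin (x - y)) * (W x y * g y)" by (simp flip: sin_W)
      also have "sin (x + y) * sin (x - y) = (cos (2 * y) - cos (2 * x)) / 2"
        using sin_times_sin[of "x + y" "x - y"] by simp
      finally show "A x * (sin (x + y) * A' y * g y) - A' x * (sin (x + y) * A y * g y) =
          (cos (2 * y) * (W x y * g y) - cos (2 * x) * (W x y * g y)) / 2"
        by (simp add: algebra_simps diff_divide_distrib)
    qed
    also have "?J \<dots> = (?J (\<lambda>y. cos (2 * y) * (W x y * g y)) - cos (2 * x) * T g x) / 2"
    proof -
      have "?J (\<lambda>y. cos (2 * y) * (W x y * g y) - cos (2 * x) * (W x y * g y)) =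
          ?J (\<lambda>y. cos (2 * y) * (W x y * g y)) - cos (2 * x) * T g x"
        unfolding T_def integral_cmult_real[symmetric]
        by (intro integral_diff_cont continuous_intros)
      then show ?thesis using integral_cmult_real[of ?I "1/2"] by simp
    qed
    finally have "nu * g'' x + alpha * cos (2 * x) * (nu * g x) =
        T g'' x + alpha * ?J (\<lambda>y. cos (2 * y) * (W x y * g y))"
      unfolding eig by (simp add: algebra_simps diff_divide_distrib)
    also have "\<dots> = ?J (\<lambda>y. W x y * g'' y + alpha * (cos (2 * y) * (W x y * g y)))"
      unfolding T_def integral_cmult_real[symmetric]
      by (intro integral_add_cont[symmetric] continuous_intros)
    also have "\<dots> = T (\<lambda>y. g'' y + alpha * cos (2 * y) * g y) x"
      unfolding T_def by (simp add: algebra_simps)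
    finally show ?thesis by (simp add: algebra_simps)
  qed
  then show ?thesis using dg dg' cg'' that by blast
qed

lemma simple_eigenfunction_solves:
  assumes nu: "nu \<noteq> 0" and simple: "simple_eigenvalue W nu" and f: "eigenfun W nu f"
  shows "\<exists>g. C2_fun g \<and> periodic2pi g \<and> (AE x in lebesgue. x \<in> {0..2*pi} \<longrightarrow> f x = g x) \<and>
      (\<exists>mu. mathieu_sol alpha mu g)"
proof -
  let ?I = "{0..2*pi}"
  have fL2: "L2 f" and f_ae: "AE x in lebesgue. x \<in> ?I \<longrightarrow> int_op W f x = nu * f x"
    using f by (auto simp: eigenfun_def)
  \<comment> \<open>\<open>f\<close> satisfies its equation only almost everywhere; this quotient is
    defined at every point, continuous and periodic.\<close>
  define g where "g x = int_op W f x / nu" for x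
  have g: "continuous_on UNIV g"
    unfolding g_def[abs_def] using nu by (intro continuous_intros cont_int_op[OF fL2]) auto
  have per: "periodic2pi g"
    by (simp add: periodic2pi_def g_def int_op_def W_periodic)
  have fg: "AE x in lebesgue. x \<in> ?I \<longrightarrow> f x = g x"
    using f_ae by (rule eventually_mono) (use nu in \<open>auto simp: g_def\<close>)
  have eig: "T g x = nu * g x" for x
  proof -
    have m: "(\<lambda>y. indicator ?I y *\<^sub>R (W x y * k y)) \<in> borel_measurable lebesgue" if "L2 k" for k
    proof -
      have "(\<lambda>y. indicator ?I y *\<^sub>R k y) \<in> borel_measurable lebesgue"
        using that by (simp add: L2_def set_borel_measurable_def)
      moreover have "W x \<in> borel_measurable lebesgue"
        by (intro measurable_completion) (simp add: borel_measurable_continuous_onI continuous_intros)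
      ultimately have "(\<lambda>y. W x y * (indicator ?I y *\<^sub>R k y)) \<in> borel_measurable lebesgue"
        by (rule borel_measurable_times[rotated])
      then show ?thesis by (simp add: mult.left_commute)
    qed
    have "T g x = int_op W g x" by (simp add: T_def int_op_eq_integral[OF g])
    also have "\<dots> = int_op W f x"
      unfolding int_op_def set_lebesgue_integral_def
      by (rule integral_cong_AE[OF m[OF continuous_imp_L2[OF g]] m[OF fL2]])
        (use fg in \<open>rule eventually_mono, simp add: indicator_def\<close>)
    finally show ?thesis using nu by (simp add: g_def)
  qed
  obtain g' g'' where dg: "\<And>x. (g has_real_derivative g' x) (at x)"
    and dg': "\<And>x. (g' has_real_derivative g'' x) (at x)" and cg'': "continuous_on UNIV g''"
    and Tg: "\<And>x. T (\<lambda>y. g'' y + alpha * cos (2 * y) * g y) x = nu * (g'' x + alpha * cos (2 * x) * g x)"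
    using eigenfunction_smooth[OF nu g per eig] by blast
  define h where "h x = g'' x + alpha * cos (2 * x) * g x" for x
  have ch: "continuous_on UNIV h"
    unfolding h_def[abs_def] by (intro continuous_intros cg'' g)
  have pg'': "periodic2pi g''" by (intro periodic_deriv[OF dg'] periodic_deriv[OF dg] per)
  have "\<exists>c. AE x in lebesgue. x \<in> ?I \<longrightarrow> h x = c * f x"
  \<comment> \<open>\<open>eigenfun\<close> excludes functions that vanish almost everywhere, so
    simplicity cannot be applied to such an \<open>h\<close>; there \<open>c = 0\<close>.\<close>
  proof (cases "AE x in lebesgue. x \<in> ?I \<longrightarrow> h x = 0")
    case True
    then show ?thesis by (intro exI[of _ 0]) simp
  next
    case False
    have "int_op W h x = nu * h x" for x
      unfolding int_op_eq_integral[OF ch] using Tg[of x] by (simp add: T_def h_def)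
    then have "eigenfun W nu h"
      using False continuous_imp_L2[OF ch] by (simp add: eigenfun_def)
    then show ?thesis using simple f unfolding simple_eigenvalue_def by blast
  qed
  then obtain c where c: "AE x in lebesgue. x \<in> ?I \<longrightarrow> h x = c * f x" by blast
  have "AE x in lebesgue. x \<in> ?I \<longrightarrow> h x - c * g x = 0"
    using c fg by eventually_elim auto
  moreover have "continuous_on UNIV (\<lambda>x. h x - c * g x)" by (intro continuous_intros ch g)
  moreover have "periodic2pi (\<lambda>x. h x - c * g x)"
  proof -
    have "cos (2 * (x + 2 * pi)) = cos (2 * x)" for x
      using cos_periodic[of "2 * x + 2 * pi"] cos_periodic[of "2 * x"] by (simp add: algebra_simps)
    then show ?thesis using pg'' per by (simp only: periodic2pi_def h_def simp_thms)
  qed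
  ultimately have hc: "h x - c * g x = 0" for x using AE_zero_imp_zero by blast
  \<comment> \<open>The relation \<open>h = c * g\<close> is the Mathieu equation with
    \<open>mu = - c\<close>.\<close>
  have "g'' x = - (- c + alpha * cos (2 * x)) * g x" for x
    using hc[of x] by (simp add: h_def algebra_simps)
  then have "mathieu_sol alpha (- c) g"
    unfolding mathieu_sol_def using dg dg' by (intro exI[of _ g']) auto
  moreover have "C2_fun g" unfolding C2_fun_def using dg dg' cg'' by blast
  ultimately show ?thesis using per fg by blast
qed

end

section \<open>Infinitely many periodic solutions\<close>

text \<open>For either sign of \<open>x\<close> the differentiated expression is the integral of
  \<open>f\<close> from 0 to \<open>x\<close>.\<close>

lemma scaled_integral_deriv:
  fixes f :: "real \<Rightarrow> real"
  assumes "continuous_on UNIV f"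
  shows "((\<lambda>x. x * integral {0..1} (\<lambda>t. f (t * x))) has_real_derivative f x) (at x)"
proof -
  have "\<exists>F. \<forall>x::real. - \<infinity> < ereal x \<longrightarrow> ereal x < \<infinity> \<longrightarrow> (F has_vector_derivative f x) (at x)"
    using assms by (intro einterval_antiderivative) (auto simp: continuous_on_eq_continuous_at)
  then obtain F where F: "\<And>x. (F has_real_derivative f x) (at x)"
    by (auto simp: has_real_derivative_iff_has_vector_derivative)
  have "(\<lambda>x. x * integral {0..1} (\<lambda>t. f (t * x))) = (\<lambda>x. F x - F 0)"
    using hadamard_quotient_eq[OF F, of _ 0] by auto
  moreover have "((\<lambda>x. F x - F 0) has_real_derivative f x - 0) (at x)"
    by (intro DERIV_diff F DERIV_const)
  ultimately show ?thesis by simp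
qed

lemma integral_power_01: "integral {0..1::real} (\<lambda>t. t ^ n) = 1 / real (Suc n)"
proof -
  have "((\<lambda>x. x ^ Suc n / real (Suc n)) has_real_derivative x ^ n) (at x)" for x :: real
    using DERIV_cdivide[OF DERIV_pow[of "Suc n" x], of "real (Suc n)"] by (simp del: of_nat_Suc)
  from hadamard_quotient_eq[of "\<lambda>x. x ^ Suc n / real (Suc n)" "\<lambda>x. x ^ n" 1 0, OF this]
  show ?thesis by simp
qed

text \<open>Picard iterates, with \<open>\<lambda> = k\<^sup>2\<close>, of the Volterra equation
  \<open>y x = sin (k x) / k - (\<alpha> / k) \<integral>\<^sub>0\<^sup>x sin (k (x - s)) cos (2 s) y s ds\<close>; the substitution
  \<open>s = t x\<close> makes the bounds uniform in the sign of \<open>x\<close>.\<close>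

primrec picard_term :: "real \<Rightarrow> nat \<Rightarrow> real \<Rightarrow> real \<Rightarrow> real" where
  "picard_term alpha 0 k x = sin (k * x) / k"
| "picard_term alpha (Suc n) k x =
     - (alpha / k) * (x * integral {0..1} (\<lambda>t. sin (k * (x - t * x)) * cos (2 * (t * x)) * picard_term alpha n k (t * x)))"

definition odd_sol :: "real \<Rightarrow> real \<Rightarrow> real \<Rightarrow> real" where
  "odd_sol alpha k x = (\<Sum>n. picard_term alpha n k x)"

text \<open>Continuity has to be joint, since the intermediate value theorem is applied in
  \<open>k\<close>. The range \<open>k \<ge> 1\<close> avoids the singularity at
  \<open>k = 0\<close>.\<close>

lemma cont_picard_term_pair:
  "continuous_on ({1..} \<times> UNIV) (\<lambda>p. picard_term alpha n (fst p) (snd p))"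
proof (induction n)
  case 0
  show ?case by (simp, intro continuous_intros) auto
next
  case (Suc n)
  have c: "continuous_on (({1..} \<times> UNIV) \<times> cbox 0 1)
      (\<lambda>q. picard_term alpha n (fst (fst q)) (snd q * snd (fst q)))"
  proof -
    have "continuous_on (({1..} \<times> UNIV) \<times> cbox 0 1)
        (\<lambda>q::(real \<times> real) \<times> real. (fst (fst q), snd q * snd (fst q)))"
      by (intro continuous_intros)
    moreover have "(\<lambda>q::(real \<times> real) \<times> real. (fst (fst q), snd q * snd (fst q))) ` (({1..} \<times> UNIV) \<times> cbox 0 1)
        \<subseteq> {1..} \<times> UNIV" by auto
    ultimately show ?thesis using continuous_on_compose2[OF Suc] by fastforce
  qed
  have "continuous_on ({1..} \<times> UNIV) (\<lambda>p. integral (cbox 0 1) (\<lambda>t. sin (fst p * (snd p - t * snd p)) *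
      cos (2 * (t * snd p)) * picard_term alpha n (fst p) (t * snd p)))"
    by (rule integral_continuous_on_param, unfold case_prod_beta) (intro continuous_intros c)
  then show ?case by (simp, intro continuous_intros) auto
qed

lemma cont_picard_term [continuous_intros]:
  assumes "continuous_on X f" "continuous_on X g" "\<And>x. x \<in> X \<Longrightarrow> f x \<ge> 1"
  shows "continuous_on X (\<lambda>x. picard_term alpha n (f x) (g x))"
  using continuous_on_compose2[OF cont_picard_term_pair continuous_on_Pair[OF assms(1,2)]] assms(3)
  by auto

text \<open>Each iteration contributes \<open>|alpha| * |x| / k\<close> and, from the integral of
  \<open>t ^ n\<close>, a factor \<open>1 / (n + 1)\<close>. The powers of \<open>k\<close> are kept
  because they make the correction to \<open>sin (k * x) / k\<close> small for large
  \<open>k\<close>.\<close>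

lemma picard_term_bound:
  assumes "k \<ge> 1"
  shows "\<bar>picard_term alpha n k x\<bar> \<le> 1 / k * ((\<bar>alpha\<bar> * \<bar>x\<bar> / k) ^ n / fact n)"
proof (induction n arbitrary: x)
  case 0
  show ?case using assms by (simp add: divide_right_mono)
next
  case (Suc n)
  let ?f = "\<lambda>t. sin (k * (x - t * x)) * cos (2 * (t * x)) * picard_term alpha n k (t * x)"
  let ?c = "1 / k * ((\<bar>alpha\<bar> * \<bar>x\<bar> / k) ^ n / fact n)"
  have "norm (integral {0..1} ?f) \<le> integral {0..1} (\<lambda>t. ?c * t ^ n)"
  proof (rule integral_norm_bound_integral)
    show "?f integrable_on {0..1}"
      using assms by (intro integrable_continuous_real continuous_intros)
    show "(\<lambda>t. ?c * t ^ n) integrable_on {0..1}"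
      by (intro integrable_continuous_real continuous_intros)
    fix t :: real assume t: "t \<in> {0..1}"
    have "\<bar>sin (k * (x - t * x)) * cos (2 * (t * x))\<bar> \<le> 1"
      using mult_mono[OF abs_sin_le_one abs_cos_le_one] by (simp add: abs_mult)
    then have "norm (?f t) \<le> 1 * \<bar>picard_term alpha n k (t * x)\<bar>"
      unfolding real_norm_def abs_mult[of _ "picard_term alpha n k (t * x)"] by (intro mult_right_mono) auto
    also have "\<dots> \<le> 1 / k * ((\<bar>alpha\<bar> * \<bar>t * x\<bar> / k) ^ n / fact n)" using Suc.IH[of "t * x"] by simp
    also have "\<bar>alpha\<bar> * \<bar>t * x\<bar> / k = \<bar>alpha\<bar> * \<bar>x\<bar> / k * t" using t by (simp add: abs_mult)
    also have "1 / k * ((\<bar>alpha\<bar> * \<bar>x\<bar> / k * t) ^ n / fact n) = ?c * t ^ n"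
      unfolding power_mult_distrib[of _ t] by simp
    finally show "norm (?f t) \<le> ?c * t ^ n" .
  qed
  also have "\<dots> = ?c * (1 / real (Suc n))"
    by (simp only: integral_cmult_real integral_power_01)
  finally have *: "\<bar>integral {0..1} ?f\<bar> \<le> ?c * (1 / real (Suc n))" by simp
  have "\<bar>picard_term alpha (Suc n) k x\<bar> = \<bar>alpha\<bar> * \<bar>x\<bar> / k * \<bar>integral {0..1} ?f\<bar>"
    using assms by (simp add: abs_mult)
  also have "\<dots> \<le> \<bar>alpha\<bar> * \<bar>x\<bar> / k * (?c * (1 / real (Suc n)))"
    using * assms by (intro mult_left_mono) auto
  also have "\<dots> = 1 / k * ((\<bar>alpha\<bar> * \<bar>x\<bar> / k) ^ Suc n / fact (Suc n))" by simp
  finally show ?case .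
qed

text \<open>A majorant free of \<open>k\<close>, for the Weierstrass test in both variables.\<close>

lemma picard_term_bound_uniform:
  assumes "k \<ge> 1" "\<bar>x\<bar> \<le> B"
  shows "\<bar>picard_term alpha n k x\<bar> \<le> (\<bar>alpha\<bar> * B) ^ n / fact n"
proof -
  have B: "0 \<le> B" using assms by linarith
  have "\<bar>alpha\<bar> * \<bar>x\<bar> / k \<le> \<bar>alpha\<bar> * B / 1"
    using assms B by (intro frac_le mult_left_mono) auto
  then have "1 / k * ((\<bar>alpha\<bar> * \<bar>x\<bar> / k) ^ n / fact n) \<le> 1 * ((\<bar>alpha\<bar> * B) ^ n / fact n)"
    using assms B by (intro mult_mono divide_right_mono power_mono) auto
  then show ?thesis using picard_term_bound[OF assms(1), of alpha n x] by linarith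
qed

lemma summable_exp_majorant: "summable (\<lambda>n. (c::real) ^ n / fact n)"
  using summable_exp[of c] by (simp add: divide_inverse mult.commute)

lemma summable_picard_term: "k \<ge> 1 \<Longrightarrow> summable (\<lambda>n. picard_term alpha n k x)"
  by (rule summable_comparison_test'[OF summable_exp_majorant[of "\<bar>alpha\<bar> * \<bar>x\<bar>"]])
    (use picard_term_bound_uniform[of k x "\<bar>x\<bar>"] in auto)

lemma cont_odd_sol_pair:
  "continuous_on ({1..} \<times> {-B..B}) (\<lambda>p. odd_sol alpha (fst p) (snd p))"
proof (rule uniform_limit_theorem)
  show "uniform_limit ({1..} \<times> {-B..B}) (\<lambda>N p. \<Sum>n<N. picard_term alpha n (fst p) (snd p))
      (\<lambda>p. odd_sol alpha (fst p) (snd p)) sequentially"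
    unfolding odd_sol_def
    by (rule Weierstrass_m_test[OF _ summable_exp_majorant[of "\<bar>alpha\<bar> * B"]])
      (auto intro!: picard_term_bound_uniform)
  show "\<forall>\<^sub>F N in sequentially. continuous_on ({1..} \<times> {-B..B})
      (\<lambda>p. \<Sum>n<N. picard_term alpha n (fst p) (snd p))"
    by (intro always_eventually allI continuous_intros) auto
qed simp

lemma cont_odd_sol:
  assumes "k \<ge> 1"
  shows "continuous_on UNIV (odd_sol alpha k)"
proof (rule continuous_at_imp_continuous_on, rule ballI)
  fix x :: real
  have "continuous_on {- (\<bar>x\<bar> + 1)..\<bar>x\<bar> + 1} (\<lambda>x. odd_sol alpha (fst (k, x)) (snd (k, x)))"
    by (rule continuous_on_compose2[OF cont_odd_sol_pair[of "\<bar>x\<bar> + 1" alpha]])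
      (use assms in \<open>auto intro!: continuous_intros\<close>)
  then show "isCont (odd_sol alpha k) x"
    by (intro continuous_on_interior[of "{- (\<bar>x\<bar> + 1)..\<bar>x\<bar> + 1}"]) auto
qed

text \<open>Uniform convergence allows integration term by term. By the recursion this yields the
  series from index 1 on, and term 0 is the forcing \<open>sin (k * x) / k\<close>.\<close>

lemma odd_sol_volterra:
  assumes k: "k \<ge> 1"
  shows "odd_sol alpha k x = sin (k * x) / k - (alpha / k) *
    (x * integral {0..1} (\<lambda>t. sin (k * (x - t * x)) * cos (2 * (t * x)) * odd_sol alpha k (t * x)))"
proof -
  define c where "c t = sin (k * (x - t * x)) * cos (2 * (t * x))" for t
  have c: "continuous_on UNIV c" unfolding c_def by (intro continuous_intros)
  have c1: "\<bar>c t\<bar> \<le> 1" for t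
    unfolding c_def using mult_mono[OF abs_sin_le_one abs_cos_le_one] by (simp add: abs_mult)
  have sum_c: "(\<Sum>n. c t * picard_term alpha n k (t * x)) = c t * odd_sol alpha k (t * x)" for t
    unfolding odd_sol_def by (rule suminf_mult[OF summable_picard_term[OF k]])
  have cont: "continuous_on {0..1} (\<lambda>t. c t * picard_term alpha n k (t * x))" for n
    using k by (intro continuous_intros continuous_on_subset[OF c]) auto
  have "uniform_limit {0..1} (\<lambda>N t. \<Sum>n<N. c t * picard_term alpha n k (t * x))
      (\<lambda>t. \<Sum>n. c t * picard_term alpha n k (t * x)) sequentially"
  proof (rule Weierstrass_m_test[OF _ summable_exp_majorant[of "\<bar>alpha\<bar> * \<bar>x\<bar>"]])
    fix n and t :: real assume t: "t \<in> {0..1}"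
    have "\<bar>t * x\<bar> \<le> \<bar>x\<bar>" using t by (simp add: abs_mult mult_left_le_one_le)
    from picard_term_bound_uniform[OF k this]
    have "\<bar>picard_term alpha n k (t * x)\<bar> \<le> (\<bar>alpha\<bar> * \<bar>x\<bar>) ^ n / fact n" .
    with c1 have "\<bar>c t\<bar> * \<bar>picard_term alpha n k (t * x)\<bar> \<le> 1 * ((\<bar>alpha\<bar> * \<bar>x\<bar>) ^ n / fact n)"
      by (intro mult_mono) auto
    then show "norm (c t * picard_term alpha n k (t * x)) \<le> (\<bar>alpha\<bar> * \<bar>x\<bar>) ^ n / fact n"
      by (simp add: abs_mult)
  qed
  then have ul: "uniform_limit {0..1} (\<lambda>N t. \<Sum>n<N. c t * picard_term alpha n k (t * x))
      (\<lambda>t. c t * odd_sol alpha k (t * x)) sequentially"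
    unfolding sum_c .
  have cs: "continuous_on {0..1} (\<lambda>t. \<Sum>n<N. c t * picard_term alpha n k (t * x))" for N
    by (intro continuous_on_sum cont)
  obtain I J where I: "\<And>N. ((\<lambda>t. \<Sum>n<N. c t * picard_term alpha n k (t * x)) has_integral I N) {0..1}"
    and J: "((\<lambda>t. c t * odd_sol alpha k (t * x)) has_integral J) {0..1}" and IJ: "I \<longlonglongrightarrow> J"
    by (rule uniform_limit_integral[OF ul cs]) (simp, rule that)
  have "I = (\<lambda>N. \<Sum>n<N. integral {0..1} (\<lambda>t. c t * picard_term alpha n k (t * x)))"
  proof
    fix N
    show "I N = (\<Sum>n<N. integral {0..1} (\<lambda>t. c t * picard_term alpha n k (t * x)))"
      using integral_unique[OF I[of N]]
      by (subst (asm) integral_sum) (auto intro!: integrable_continuous_real cont)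
  qed
  then have "(\<lambda>n. integral {0..1} (\<lambda>t. c t * picard_term alpha n k (t * x))) sums J"
    using IJ unfolding sums_def by simp
  then have "(\<lambda>n. - (alpha / k) * (x * integral {0..1} (\<lambda>t. c t * picard_term alpha n k (t * x))))
      sums (- (alpha / k) * (x * J))"
    by (intro sums_mult)
  then have "(\<lambda>n. picard_term alpha (Suc n) k x) sums (- (alpha / k) * (x * J))"
    by (simp only: picard_term.simps c_def)
  then have "(\<lambda>n. picard_term alpha n k x) sums (- (alpha / k) * (x * J) + picard_term alpha 0 k x)"
    by (rule sums_Suc[of "\<lambda>n. picard_term alpha n k x"])
  then have "odd_sol alpha k x = - (alpha / k) * (x * J) + picard_term alpha 0 k x"
    unfolding odd_sol_def by (rule sums_unique[symmetric])
  moreover have "J = integral {0..1} (\<lambda>t. c t * odd_sol alpha k (t * x))"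
    by (rule integral_unique[OF J, symmetric])
  ultimately show ?thesis by (simp add: c_def)
qed

section \<open>The series solves Mathieu's equation\<close>

lemma odd_sol_mathieu:
  assumes k: "k \<ge> 1"
  obtains y' where "mathieu_pair alpha (k\<^sup>2) (odd_sol alpha k) y'" "odd_sol alpha k 0 = 0" "y' 0 = 1"
proof -
  define y where "y = odd_sol alpha k"
  note cy = cont_odd_sol[OF k, of alpha, folded y_def]
  \<comment> \<open>The addition formula for \<open>sin (k * (x - s))\<close> moves \<open>x\<close>
    out of the Volterra integral. \<open>P\<close> and \<open>Q\<close> are the remaining integrals
    from 0 to \<open>x\<close>, differentiable since \<open>y\<close> is continuous. As in variation
    of constants, the derivatives of \<open>P\<close> and \<open>Q\<close> cancel in
    \<open>y'\<close>; in \<open>y''\<close> they combine through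
    \<open>sin^2 + cos^2 = 1\<close>.\<close>
  define P where "P x = x * integral {0..1} (\<lambda>t. cos (k * (t * x)) * cos (2 * (t * x)) * y (t * x))" for x
  define Q where "Q x = x * integral {0..1} (\<lambda>t. sin (k * (t * x)) * cos (2 * (t * x)) * y (t * x))" for x
  have P: "(P has_real_derivative cos (k * x) * cos (2 * x) * y x) (at x)" for x
    unfolding P_def[abs_def]
    by (rule scaled_integral_deriv[of "\<lambda>s. cos (k * s) * cos (2 * s) * y s"]) (intro continuous_intros cy)
  have Q: "(Q has_real_derivative sin (k * x) * cos (2 * x) * y x) (at x)" for x
    unfolding Q_def[abs_def]
    by (rule scaled_integral_deriv[of "\<lambda>s. sin (k * s) * cos (2 * s) * y s"]) (intro continuous_intros cy)
  have y_eq: "y = (\<lambda>x. sin (k * x) / k - (alpha / k) * (sin (k * x) * P x - cos (k * x) * Q x))"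
  proof
    fix x
    let ?J = "integral {0..1::real}"
    note cy' = continuous_on_compose2[OF cy, of "{0..1}" "\<lambda>t. t * x"]
    have "?J (\<lambda>t. sin (k * (x - t * x)) * cos (2 * (t * x)) * y (t * x)) =
        ?J (\<lambda>t. sin (k * x) * (cos (k * (t * x)) * cos (2 * (t * x)) * y (t * x))
              - cos (k * x) * (sin (k * (t * x)) * cos (2 * (t * x)) * y (t * x)))"
      by (simp add: right_diff_distrib sin_diff algebra_simps)
    also have "\<dots> = ?J (\<lambda>t. sin (k * x) * (cos (k * (t * x)) * cos (2 * (t * x)) * y (t * x)))
              - ?J (\<lambda>t. cos (k * x) * (sin (k * (t * x)) * cos (2 * (t * x)) * y (t * x)))"
      by (intro integral_diff integrable_continuous_real continuous_intros cy') auto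
    also have "\<dots> = sin (k * x) * ?J (\<lambda>t. cos (k * (t * x)) * cos (2 * (t * x)) * y (t * x))
              - cos (k * x) * ?J (\<lambda>t. sin (k * (t * x)) * cos (2 * (t * x)) * y (t * x))"
      unfolding integral_cmult_real ..
    finally show "y x = sin (k * x) / k - (alpha / k) * (sin (k * x) * P x - cos (k * x) * Q x)"
      unfolding P_def Q_def using odd_sol_volterra[OF k, of alpha x, folded y_def]
      by (simp add: right_diff_distrib mult_ac)
  qed
  define y' where "y' x = cos (k * x) - alpha * (cos (k * x) * P x + sin (k * x) * Q x)" for x
  have "mathieu_pair alpha (k\<^sup>2) y y'"
    unfolding mathieu_pair_def
  proof (intro allI conjI)
    fix x
    let ?s = "sin (k * x)" and ?c = "cos (k * x)"
    have sc: "((\<lambda>x. sin (k * x)) has_real_derivative k * ?c) (at x)"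
      "((\<lambda>x. cos (k * x)) has_real_derivative - k * ?s) (at x)"
      by (auto intro!: derivative_eq_intros)
    have "((\<lambda>x. sin (k * x) / k - (alpha / k) * (sin (k * x) * P x - cos (k * x) * Q x))
        has_real_derivative k * ?c / k - (alpha / k) *
          (k * ?c * P x + ?c * cos (2 * x) * y x * ?s - (- k * ?s * Q x + ?s * cos (2 * x) * y x * ?c))) (at x)"
      by (intro DERIV_diff DERIV_cdivide DERIV_cmult DERIV_mult sc P Q)
    also have "k * ?c / k - (alpha / k) *
        (k * ?c * P x + ?c * cos (2 * x) * y x * ?s - (- k * ?s * Q x + ?s * cos (2 * x) * y x * ?c)) = y' x"
      using k by (simp add: y'_def field_simps)
    finally have "((\<lambda>x. sin (k * x) / k - (alpha / k) * (sin (k * x) * P x - cos (k * x) * Q x))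
        has_real_derivative y' x) (at x)" .
    then show "(y has_real_derivative y' x) (at x)" by (subst y_eq)
    have d: "(y' has_real_derivative (- k * ?s - alpha * ((- k * ?s) * P x + ?c * (?c * cos (2 * x) * y x)
        + (k * ?c * Q x + ?s * (?s * cos (2 * x) * y x))))) (at x)"
      unfolding y'_def[abs_def] by (rule derivative_eq_intros P Q refl)+ (simp add: algebra_simps)
    have t1: "?c * (?c * cos (2 * x) * y x) + ?s * (?s * cos (2 * x) * y x) = cos (2 * x) * y x"
    proof -
      have "?c * (?c * cos (2 * x) * y x) + ?s * (?s * cos (2 * x) * y x) = (?s\<^sup>2 + ?c\<^sup>2) * (cos (2 * x) * y x)"
        unfolding power2_eq_square by (simp only: algebra_simps)
      then show ?thesis by simp
    qed
    have t2: "k\<^sup>2 * y x = k * ?s - alpha * k * (?s * P x - ?c * Q x)"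
    proof -
      have "k * y x = ?s - alpha * (?s * P x - ?c * Q x)"
        using k fun_cong[OF y_eq, of x] by (simp add: field_simps)
      then have "k * (k * y x) = k * (?s - alpha * (?s * P x - ?c * Q x))" by simp
      then show ?thesis by (simp add: power2_eq_square algebra_simps)
    qed
    have "- k * ?s - alpha * ((- k * ?s) * P x + ?c * (?c * cos (2 * x) * y x)
          + (k * ?c * Q x + ?s * (?s * cos (2 * x) * y x))) =
        - (k * ?s - alpha * k * (?s * P x - ?c * Q x))
        - alpha * (?c * (?c * cos (2 * x) * y x) + ?s * (?s * cos (2 * x) * y x))"
      by (simp add: algebra_simps)
    also have "\<dots> = - (k\<^sup>2 + alpha * cos (2 * x)) * y x"
      unfolding t1 t2[symmetric] by (simp add: algebra_simps)
    finally show "(y' has_real_derivative - (k\<^sup>2 + alpha * cos (2 * x)) * y x) (at x)"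
      using d by simp
  qed
  moreover have "y 0 = 0" by (subst y_eq) (simp add: P_def Q_def)
  moreover have "y' 0 = 1" by (simp add: y'_def P_def Q_def)
  ultimately show ?thesis using that unfolding y_def by blast
qed

text \<open>A zero at 0 makes \<open>y\<close> odd about 0, a zero at \<open>pi\<close> makes it odd
  about \<open>pi\<close>, and the composition of the two point reflections is the translation by
  \<open>2 * pi\<close>.\<close>

lemma periodic_of_odd_zero:
  assumes y: "mathieu_pair alpha lam y y'" and y0: "y 0 = 0" and y1: "y pi = 0"
  shows "y (x + 2 * pi) = y x"
proof -
  have odd: "y x = - y (- x)" for x
    by (rule mathieu_pair_unique2[OF y mathieu_pair_reflect[OF y], of 0]) (simp_all add: y0)
  note S = mathieu_pair_shift_pi[OF y]
  have "y (x + pi) = - y (- x + pi)" for x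
    by (rule mathieu_pair_unique2[OF S mathieu_pair_reflect[OF S], of 0]) (simp_all add: y1)
  from this[of "x + pi"] have "y (x + 2 * pi) = - y (- x)" by (simp add: add.assoc)
  then show ?thesis using odd[of x] by simp
qed

text \<open>Term 0 of the series is the sine; the tail is dominated by the exponential series
  without its leading 1.\<close>

lemma odd_sol_asymptotics:
  assumes k: "k \<ge> 1"
  shows "\<bar>k * odd_sol alpha k x - sin (k * x)\<bar> \<le> exp (\<bar>alpha\<bar> * \<bar>x\<bar> / k) - 1"
proof -
  let ?z = "\<bar>alpha\<bar> * \<bar>x\<bar> / k"
  note sm = summable_picard_term[OF k, of alpha x]
  have m: "(\<lambda>n. ?z ^ n / fact n) sums exp ?z"
    using exp_converges[of ?z] by (simp add: divide_inverse mult.commute)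
  then have m1: "(\<lambda>n. ?z ^ Suc n / fact (Suc n)) sums (exp ?z - 1)"
    using sums_Suc_iff[of "\<lambda>n. ?z ^ n / fact n" "exp ?z - 1"] by simp
  have "odd_sol alpha k x - sin (k * x) / k = (\<Sum>n. picard_term alpha (Suc n) k x)"
    unfolding odd_sol_def using suminf_split_head[OF sm] by simp
  also have "norm \<dots> \<le> (\<Sum>n. 1 / k * (?z ^ Suc n / fact (Suc n)))"
  proof (rule norm_suminf_le)
    show "norm (picard_term alpha (Suc n) k x) \<le> 1 / k * (?z ^ Suc n / fact (Suc n))" for n
      using picard_term_bound[OF k] unfolding real_norm_def .
    show "summable (\<lambda>n. 1 / k * (?z ^ Suc n / fact (Suc n)))"
      by (rule sums_summable[OF sums_mult[OF m1]])
  qed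
  also have "\<dots> = 1 / k * (exp ?z - 1)"
    using sums_unique[OF sums_mult[OF m1, of "1 / k"]] by simp
  finally have "k * \<bar>odd_sol alpha k x - sin (k * x) / k\<bar> \<le> k * (1 / k * (exp ?z - 1))"
    using k by (intro mult_left_mono) auto
  moreover have "k * \<bar>odd_sol alpha k x - sin (k * x) / k\<bar> = \<bar>k * odd_sol alpha k x - sin (k * x)\<bar>"
  proof -
    have "k * \<bar>odd_sol alpha k x - sin (k * x) / k\<bar> = \<bar>k * (odd_sol alpha k x - sin (k * x) / k)\<bar>"
      using k by (simp add: abs_mult)
    then show ?thesis using k by (simp add: right_diff_distrib)
  qed
  ultimately show ?thesis using k by simp
qed

section \<open>Intermediate value argument in k\<close>

lemma ex_periodic_above:
  "\<exists>lam > B. \<exists>A. mathieu_periodic_sol alpha lam A"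
proof -
  \<comment> \<open>The summand \<open>2 * |alpha| * pi\<close> pushes the exponent in
    \<open>odd_sol_asymptotics\<close> below 1/2, so the error is less than
    \<open>exp (1/2) - 1 \<le> 1\<close>; \<open>|B| + 1\<close> ensures \<open>k \<ge> 1\<close>
    and \<open>k > |B|\<close>, whence \<open>k * k \<ge> k > B\<close>.\<close>
  obtain m :: nat where m: "real m > 2 * \<bar>alpha\<bar> * pi + \<bar>B\<bar> + 1"
    using reals_Archimedean2 by blast
  have ap: "0 \<le> \<bar>alpha\<bar> * pi" by simp
  define F where "F k = k * odd_sol alpha k pi" for k
  have sgnF: "\<bar>F k - sin (k * pi)\<bar> < 1" if "k \<ge> real m" for k
  proof -
    have k1: "k \<ge> 1" and k2: "k > 2 * (\<bar>alpha\<bar> * pi)" using that m ap by linarith+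
    have "\<bar>alpha\<bar> * \<bar>pi\<bar> / k < 1 / 2" using k1 k2 by (simp add: field_simps)
    then have "exp (\<bar>alpha\<bar> * \<bar>pi\<bar> / k) < exp (1 / 2)" by simp
    also have "\<dots> \<le> 2" by (rule exp_half_le2)
    finally show ?thesis using odd_sol_asymptotics[OF k1, of alpha pi] unfolding F_def by linarith
  qed
  \<comment> \<open>At half-integers the sine is exactly 1 or -1, so an error below 1 cannot change
    the sign of \<open>F\<close>; the signs at \<open>m + 1/2\<close> and \<open>m + 3/2\<close> are
    opposite.\<close>
  have sin_half: "sin ((real n + 1 / 2) * pi) = (- 1) ^ n" for n
    by (simp add: distrib_right sin_add)
  let ?a = "real m + 1 / 2" and ?b = "real (Suc m) + 1 / 2"
  have m1: "real m \<ge> 1" using m ap by linarith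
  have cF: "continuous_on {?a..?b} F"
    unfolding F_def
  proof (intro continuous_intros)
    show "continuous_on {?a..?b} (\<lambda>k. odd_sol alpha k pi)"
    proof -
      have "continuous_on {?a..?b} (\<lambda>k. (k, pi))" by (intro continuous_intros)
      moreover have "(\<lambda>k. (k, pi)) ` {?a..?b} \<subseteq> {1..} \<times> {- pi..pi}" using m1 by auto
      ultimately show ?thesis
        using continuous_on_compose2[OF cont_odd_sol_pair[of pi alpha]] by fastforce
    qed
  qed
  have Fab: "\<bar>F ?a - (- 1) ^ m\<bar> < 1" "\<bar>F ?b + (- 1) ^ m\<bar> < 1"
    using sgnF[of ?a] sgnF[of ?b] sin_half[of m] sin_half[of "Suc m"] by auto
  have "\<exists>k. ?a \<le> k \<and> k \<le> ?b \<and> F k = 0"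
  proof (cases "even m")
    case True
    then show ?thesis using Fab cF by (intro IVT2') auto
  next
    case False
    then show ?thesis using Fab cF by (intro IVT') auto
  qed
  then obtain k where k: "?a \<le> k" "F k = 0" by blast
  have k1: "k \<ge> 1" and kB: "k > \<bar>B\<bar>" using k m ap by linarith+
  obtain y' where y: "mathieu_pair alpha (k\<^sup>2) (odd_sol alpha k) y'" "odd_sol alpha k 0 = 0" "y' 0 = 1"
    using odd_sol_mathieu[OF k1] by blast
  have "odd_sol alpha k pi = 0" using k k1 by (simp add: F_def)
  then have "periodic2pi (odd_sol alpha k)"
    unfolding periodic2pi_def using periodic_of_odd_zero[OF y(1,2)] by blast
  moreover have "\<exists>x. odd_sol alpha k x \<noteq> 0"
  proof (rule ccontr)
    assume "\<nexists>x. odd_sol alpha k x \<noteq> 0"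
    then have "odd_sol alpha k = (\<lambda>_. 0)" by auto
    moreover have "(odd_sol alpha k has_real_derivative 1) (at 0)"
      using y by (metis mathieu_pair_def)
    ultimately show False using DERIV_unique[OF DERIV_const] by fastforce
  qed
  moreover have "mathieu_sol alpha (k\<^sup>2) (odd_sol alpha k)"
    using y(1) unfolding mathieu_sol_def mathieu_pair_def by blast
  moreover have "B < k\<^sup>2"
  proof -
    have "1 * k \<le> k * k" using k1 by (intro mult_right_mono) auto
    then show ?thesis using kB unfolding power2_eq_square by linarith
  qed
  ultimately show ?thesis unfolding mathieu_periodic_sol_def by blast
qed

lemma infinite_periodic: "infinite {lam. \<exists>A. mathieu_periodic_sol alpha lam A}"
proof
  assume "finite {lam. \<exists>A. mathieu_periodic_sol alpha lam A}"
  then have "bdd_above {lam. \<exists>A. mathieu_periodic_sol alpha lam A}" by (rule bdd_above_finite)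
  then obtain B where "\<forall>lam\<in>{lam. \<exists>A. mathieu_periodic_sol alpha lam A}. lam \<le> B"
    by (auto simp: bdd_above_def)
  then show False using ex_periodic_above[of B alpha] by force
qed

text \<open>The quotient formula fixes \<open>W\<close> off the zeros of the sine, a dense set, and
  the C1 requirement determines it elsewhere. An eigenfunction is known only up to null sets, so its
  regularity is asserted of the representative \<open>g\<close>.\<close>

theorem theorem6p1:
  fixes alpha :: real
  shows "infinite {lam. \<exists>A. mathieu_periodic_sol alpha lam A}
    \<and> (\<forall>lam A. mathieu_periodic_sol alpha lam A \<longrightarrow>
         (\<exists>W :: real \<Rightarrow> real \<Rightarrow> real.
            (\<forall>x y. sin (x - y) \<noteq> 0 \<longrightarrow>
               W x y = (A x * deriv A y - deriv A x * A y) / sin (x - y)) \<and>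
            C1_fun2 W \<and>
            (\<forall>x y. W (x + 2*pi) y = W x y \<and> W x (y + 2*pi) = W x y) \<and>
            hilbert_schmidt_kernel W \<and> self_adjoint_kernel W \<and>
            (\<forall>nu f. nu \<noteq> 0 \<and> simple_eigenvalue W nu \<and> eigenfun W nu f \<longrightarrow>
               (\<exists>g. C2_fun g \<and> periodic2pi g \<and>
                    (AE x in lebesgue. x \<in> {0..2*pi} \<longrightarrow> f x = g x) \<and>
                    (\<exists>mu. mathieu_sol alpha mu g)))))"
proof (intro conjI allI impI)
  show "infinite {lam. \<exists>A. mathieu_periodic_sol alpha lam A}" by (rule infinite_periodic)
next
  fix lam A assume A: "mathieu_periodic_sol alpha lam A"
  then obtain A' where pair: "mathieu_pair alpha lam A A'"
    by (auto simp: mathieu_periodic_sol_def mathieu_sol_def mathieu_pair_def)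
  have "A (x + 2 * pi) = A x" for x
    using A by (simp add: mathieu_periodic_sol_def periodic2pi_def)
  then obtain s where "s = 1 \<or> s = -1" "\<And>x. A (x + pi) = s * A x" "\<And>x. A' (x + pi) = s * A' x"
    using periodic_imp_semiperiodic[OF pair] by blast
  with pair interpret semiperiodic_mathieu alpha lam s A A' by unfold_locales
  have "deriv A x = A' x" for x by (rule DERIV_imp_deriv[OF deriv_A])
  then have "W x y = (A x * deriv A y - deriv A x * A y) / sin (x - y)" if "sin (x - y) \<noteq> 0" for x y
    using W_eq[OF that] by (simp add: N_def)
  then show "\<exists>W :: real \<Rightarrow> real \<Rightarrow> real.
      (\<forall>x y. sin (x - y) \<noteq> 0 \<longrightarrow>
         W x y = (A x * deriv A y - deriv A x * A y) / sin (x - y)) \<and>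
      C1_fun2 W \<and>
      (\<forall>x y. W (x + 2*pi) y = W x y \<and> W x (y + 2*pi) = W x y) \<and>
      hilbert_schmidt_kernel W \<and> self_adjoint_kernel W \<and>
      (\<forall>nu f. nu \<noteq> 0 \<and> simple_eigenvalue W nu \<and> eigenfun W nu f \<longrightarrow>
         (\<exists>g. C2_fun g \<and> periodic2pi g \<and>
              (AE x in lebesgue. x \<in> {0..2*pi} \<longrightarrow> f x = g x) \<and>
              (\<exists>mu. mathieu_sol alpha mu g)))"
    using C1_fun2_W W_periodic hilbert_schmidt self_adjoint[OF W_sym] simple_eigenfunction_solves
    by (intro exI[of _ W]) blast
qed

end
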